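(* Let $\Omega\subset\mathbb{R}^2$ be the interior of a simple polygon, let $\mathscr{T}$ be a triangulation of $\overline\Omega$ with vertex set $V$ and boundary vertices $V_B$, and let $\sigma\in PC_+(\mathscr{T})$. Let $w:V\to\mathbb{R}^2$ be a map with $w|_{V_B}=0$, define $\Phi_t:V\to\mathbb{R}^2$ for $t\in\mathbb{R}$ by $\Phi_t(x_j)=x_j+t\,w(x_j)$, $x_j\in V$, and let $\beta:E_I\to\mathbb{R}$ be a function on the set of interior edges. Then for all sufficiently small $|t|$, the continuous extension of $\Phi_t$ to $\overline\Omega$ that is affine on each triangle of $\mathscr{T}$ (still denoted $\Phi_t$) is an isomorphism of $\mathscr{T}$ onto a triangulation $\mathscr{T}_t$ of $\overline\Omega$, and $$\Lambda_\sigma^{\mathrm{FEM}(\mathscr{T})}=\Lambda_{(\Phi_t)_*S_{t\beta}(\sigma)}^{\mathrm{FEM}(\mathscr{T}_t)}.$$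
   Context: Triangulation: a finite set $\mathscr{T}$ of closed (nondegenerate) triangles in $\mathbb{R}^2$ with union $\overline\Omega$, such that two distinct triangles are either disjoint or meet in exactly one common vertex or one full common edge. $V=\{x_1,\dots,x_N\}$ is the set of all vertices, labeled so that $V_B=\{x_1,\dots,x_B\}=V\cap\partial\Omega$. $E$ is the set of unordered pairs $\{x_j,x_k\}$ that are sides of triangles; $E_I$ (interior edges) consists of the edges belonging to exactly two triangles, $E_B$ (boundary edges) of those belonging to only one triangle. Triangles are oriented counterclockwise; "$\partial T$ has the same orientation as $(x,y)$" means that the counterclockwise traversal of $\partial T$ goes along that side from $x$ to $y$. Two triangulations $\mathscr{T},\mathscr{T}'$ of $\overline\Omega$ are isomorphic via $\Phi$ if $\Phi:\overline\Omega\to\overline\Omega$ is an orientation preserving homeomorphism that is affine on each triangle of $\mathscr{T}$ and gives a one-to-one correspondence between triangles of $\mathscr{T}$ and $\mathscr{T}'$; vertices of $\mathscr{T}'$ are labeled $x_j'=\Phi(x_j)$. $PC(\mathscr{T})$ is the set of $\sigma\in L^\infty(\Omega;\mathbb{R}^{2\times2})$ equal to a constant symmetric matrix in the interior of each triangle; $PC_+(\mathscr{T})$ is the subset of those that are positive definite on each triangle. Pushforward: $\Phi_*\sigma(y)=\dfrac{D\Phi(x)\,\sigma(x)\,D\Phi(x)^t}{|\det D\Phi(x)|}\Big|_{x=\Phi^{-1}(y)}$ for $y$ in the interior of a triangle of $\mathscr{T}'$. $v_k:\overline\Omega\to\mathbb{R}$ is the continuous function, affine on each triangle, with $v_k(x_k)=1$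 and $v_k(x_j)=0$ for $j\ne k$. Definition of $S_\beta(\sigma)$, for $\sigma\in PC_+(\mathscr{T})$ and $\beta:E_I\to\mathbb{R}$: it is the unique $\tilde\sigma\in PC(\mathscr{T})$ such that (ii) for $e=\{x_j,x_k\}\in E_I$ with $j<k$, if $T,T'$ are the two triangles containing $e$, with $\partial T$ oriented as $(x_j,x_k)$ and $\partial T'$ oppositely, then $\int_T\tilde\sigma\nabla v_j\cdot\nabla v_k=\int_T\sigma\nabla v_j\cdot\nabla v_k+\beta(e)$ and $\int_{T'}\tilde\sigma\nabla v_j\cdot\nabla v_k=\int_{T'}\sigma\nabla v_j\cdot\nabla v_k-\beta(e)$; (iii) for $e=\{x_j,x_k\}\in E_B$ contained in the unique triangle $T$, $\int_T\tilde\sigma\nabla v_j\cdot\nabla v_k=\int_T\sigma\nabla v_j\cdot\nabla v_k$. FEM model: $L(\sigma)=(l_{jk})_{j,k=1}^N$ has $l_{jk}=\delta_{jk}$ for $1\le j\le B$ and $l_{jk}=\int_\Omega\sigma\nabla v_j\cdot\nabla v_k\,dx$ for $B+1\le j\le N$. If $L(\sigma)$ is invertible, $\Lambda_\sigma^{\mathrm{FEM}(\mathscr{T})}:\mathbb{R}^B\to\mathbb{R}^B$ is $(\Lambda_\sigma^{\mathrm{FEM}(\mathscr{T})}f)_j=\sum_{k=1}^N\big(\int_\Omega\sigma\nabla v_j\cdot\nabla v_k\,dx\big)u_k$, $1\le j\le B$, where $L(\sigma)u=(f,0)^t$. *)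

theory Defs
  imports "HOL-Analysis.Analysis" "Jordan_Normal_Form.Matrix"
begin

(* Jordan_Normal_Form supplies the N x N matrices and length-B vectors of the discrete model, where
   N and B are term-level numbers; its infix syntax clashes with that of HOL-Analysis. *)
no_notation vec_index (infixl "$" 100)
no_notation scalar_prod (infix "\<bullet>" 70)

type_synonym plane = "real^2"

section \<open>Simple polygons\<close>

fun polygonal_path :: "plane list \<Rightarrow> real \<Rightarrow> plane" where
  "polygonal_path [] = linepath 0 0"
| "polygonal_path [a] = linepath a a"
| "polygonal_path [a, b] = linepath a b"
| "polygonal_path (a # b # c # ps) = linepath a b +++ polygonal_path (b # c # ps)"

(* Degenerate vertex lists are excluded by simple_path: at least three vertices are needed. *)
definition simple_polygon_interior :: "plane set \<Rightarrow> bool" where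
  "simple_polygon_interior \<Omega> \<longleftrightarrow>
     (\<exists>ps. ps \<noteq> [] \<and> simple_path (polygonal_path (ps @ [hd ps])) \<and>
           \<Omega> = inside (path_image (polygonal_path (ps @ [hd ps]))))"

section \<open>Triangulations\<close>

definition tri_vertices :: "plane set \<Rightarrow> plane set" where
  "tri_vertices T = {p. p extreme_point_of T}"

(* A side is recorded as the unordered pair of its endpoints; the segment itself is its convex hull. *)
definition tri_sides :: "plane set \<Rightarrow> plane set set" where
  "tri_sides T = {{p, q} |p q. p \<in> tri_vertices T \<and> q \<in> tri_vertices T \<and> p \<noteq> q}"

definition triangulation_of :: "plane set set \<Rightarrow> plane set \<Rightarrow> bool" where
  "triangulation_of \<T> S \<longleftrightarrow>
     finite \<T> \<and> (\<forall>T\<in>\<T>. 2 simplex T) \<and> \<Union>\<T> = S \<and>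
     (\<forall>T\<in>\<T>. \<forall>T'\<in>\<T>. T \<noteq> T' \<longrightarrow>
        T \<inter> T' = {} \<or>
        (\<exists>p \<in> tri_vertices T \<inter> tri_vertices T'. T \<inter> T' = {p}) \<or>
        (\<exists>e \<in> tri_sides T \<inter> tri_sides T'. T \<inter> T' = convex hull e))"

definition vertices :: "plane set set \<Rightarrow> plane set" where
  "vertices \<T> = (\<Union>T\<in>\<T>. tri_vertices T)"

definition edges :: "plane set set \<Rightarrow> plane set set" where
  "edges \<T> = (\<Union>T\<in>\<T>. tri_sides T)"

definition interior_edges :: "plane set set \<Rightarrow> plane set set" where
  "interior_edges \<T> = {e \<in> edges \<T>. card {T \<in> \<T>. e \<in> tri_sides T} = 2}"

definition boundary_edges :: "plane set set \<Rightarrow> plane set set" where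
  "boundary_edges \<T> = {e \<in> edges \<T>. card {T \<in> \<T>. e \<in> tri_sides T} = 1}"

(* Labels run over 0, ..., N-1 (as the row and column indices of Jordan_Normal_Form matrices do),
   the boundary vertices being those with labels 0, ..., B-1. *)
definition vertex_labelling ::
  "plane set \<Rightarrow> plane set set \<Rightarrow> nat \<Rightarrow> nat \<Rightarrow> (nat \<Rightarrow> plane) \<Rightarrow> bool" where
  "vertex_labelling \<Omega> \<T> N B x \<longleftrightarrow>
     B \<le> N \<and> bij_betw x {..<N} (vertices \<T>) \<and> x ` {..<B} = vertices \<T> \<inter> frontier \<Omega>"

(* The boundary of T, traversed counterclockwise, runs along a side from p to q: T lies to the left
   of the directed side, i.e. the vertices p, q, r are positively oriented for the third vertex r. *)
definition ccw_side :: "plane set \<Rightarrow> plane \<Rightarrow> plane \<Rightarrow> bool" where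
  "ccw_side T p q \<longleftrightarrow> {p, q} \<in> tri_sides T \<and>
     (\<exists>r. tri_vertices T = {p, q, r} \<and>
          (q$1 - p$1) * (r$2 - p$2) - (q$2 - p$2) * (r$1 - p$1) > 0)"

section \<open>Piecewise affine functions and isomorphisms\<close>

definition affine_map_on :: "plane set \<Rightarrow> (plane \<Rightarrow> 'b::real_normed_vector) \<Rightarrow> bool" where
  "affine_map_on S f \<longleftrightarrow> (\<exists>l c. linear l \<and> (\<forall>p\<in>S. f p = l p + c))"

(* The continuous function on the union of the triangles that is affine on each triangle and takes
   the values g at the vertices; membership in extensional only fixes the irrelevant values
   elsewhere, so that THE applies. *)
definition pl_extension ::
  "plane set set \<Rightarrow> (plane \<Rightarrow> 'b::real_normed_vector) \<Rightarrow> plane \<Rightarrow> 'b" where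
  "pl_extension \<T> g =
     (THE h. continuous_on (\<Union>\<T>) h \<and> (\<forall>T\<in>\<T>. affine_map_on T h) \<and>
             (\<forall>p\<in>vertices \<T>. h p = g p) \<and> h \<in> extensional (\<Union>\<T>))"

definition hat :: "plane set set \<Rightarrow> (nat \<Rightarrow> plane) \<Rightarrow> nat \<Rightarrow> plane \<Rightarrow> real" where
  "hat \<T> x k = pl_extension \<T> (\<lambda>p. if p = x k then 1 else 0)"

(* A homeomorphism that is affine on triangles preserves orientation when its Jacobian determinant
   is positive in the interior of every triangle. *)
definition triangulation_iso ::
  "plane set set \<Rightarrow> plane set set \<Rightarrow> (plane \<Rightarrow> plane) \<Rightarrow> bool" where
  "triangulation_iso \<T> \<T>' \<Phi> \<longleftrightarrow>
     (\<exists>\<Psi>. homeomorphism (\<Union>\<T>) (\<Union>\<T>') \<Phi> \<Psi>) \<and>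
     (\<forall>T\<in>\<T>. \<forall>p\<in>interior T. Determinants.det (jacobian \<Phi> (at p)) > 0) \<and>
     (\<forall>T\<in>\<T>. affine_map_on T \<Phi>) \<and>
     bij_betw (\<lambda>T. \<Phi> ` T) \<T> \<T>'"

section \<open>Piecewise constant conductivities\<close>

(* Elements of L^infinity are represented by the member of their a.e.-class that vanishes off the
   interiors of the triangles (the exceptional set has measure 0). *)
definition PC :: "plane set set \<Rightarrow> (plane \<Rightarrow> real^2^2) set" where
  "PC \<T> = {\<sigma>. (\<forall>T\<in>\<T>. \<exists>A. Finite_Cartesian_Product.transpose A = A \<and> (\<forall>p\<in>interior T. \<sigma> p = A)) \<and>
               (\<forall>p. p \<notin> (\<Union>T\<in>\<T>. interior T) \<longrightarrow> \<sigma> p = 0)}"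

definition PC_pos :: "plane set set \<Rightarrow> (plane \<Rightarrow> real^2^2) set" where
  "PC_pos \<T> = {\<sigma> \<in> PC \<T>. \<forall>T\<in>\<T>. \<forall>p\<in>interior T. \<forall>\<xi>. \<xi> \<noteq> 0 \<longrightarrow> (\<sigma> p *v \<xi>) \<bullet> \<xi> > 0}"

definition pushforward ::
  "plane set set \<Rightarrow> plane set set \<Rightarrow> (plane \<Rightarrow> plane) \<Rightarrow> (plane \<Rightarrow> real^2^2) \<Rightarrow> plane \<Rightarrow> real^2^2" where
  "pushforward \<T> \<T>' \<Phi> \<sigma> y =
     (if y \<in> (\<Union>T'\<in>\<T>'. interior T')
      then let p = inv_into (\<Union>\<T>) \<Phi> y; D = jacobian \<Phi> (at p)
           in (1 / \<bar>Determinants.det D\<bar>) *\<^sub>R (D ** \<sigma> p ** Finite_Cartesian_Product.transpose D)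
      else 0)"

definition grad :: "(plane \<Rightarrow> real) \<Rightarrow> plane \<Rightarrow> plane" where
  "grad f p = (THE D. GDERIV f p :> D)"

(* The gradients are defined off the edges only, hence almost everywhere. *)
definition energy ::
  "plane set set \<Rightarrow> (nat \<Rightarrow> plane) \<Rightarrow> (plane \<Rightarrow> real^2^2) \<Rightarrow> plane set \<Rightarrow> nat \<Rightarrow> nat \<Rightarrow> real" where
  "energy \<T> x \<sigma> D j k =
     (LINT p:D|lebesgue. (\<sigma> p *v grad (hat \<T> x j) p) \<bullet> grad (hat \<T> x k) p)"

definition S_transform ::
  "plane set set \<Rightarrow> nat \<Rightarrow> (nat \<Rightarrow> plane) \<Rightarrow> (plane set \<Rightarrow> real) \<Rightarrow>
   (plane \<Rightarrow> real^2^2) \<Rightarrow> plane \<Rightarrow> real^2^2" where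
  "S_transform \<T> N x \<beta> \<sigma> =
     (THE \<tau>. \<tau> \<in> PC \<T> \<and>
        (\<forall>j k T T'. j < k \<and> k < N \<and> {x j, x k} \<in> interior_edges \<T> \<and> T \<in> \<T> \<and> T' \<in> \<T> \<and>
                    ccw_side T (x j) (x k) \<and> ccw_side T' (x k) (x j) \<longrightarrow>
            energy \<T> x \<tau> T j k = energy \<T> x \<sigma> T j k + \<beta> {x j, x k} \<and>
            energy \<T> x \<tau> T' j k = energy \<T> x \<sigma> T' j k - \<beta> {x j, x k}) \<and>
        (\<forall>j k T. j < N \<and> k < N \<and> {x j, x k} \<in> boundary_edges \<T> \<and> T \<in> \<T> \<and>
                 {x j, x k} \<in> tri_sides T \<longrightarrow>
            energy \<T> x \<tau> T j k = energy \<T> x \<sigma> T j k))"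

section \<open>The finite element model\<close>

definition fem_matrix ::
  "plane set \<Rightarrow> plane set set \<Rightarrow> nat \<Rightarrow> nat \<Rightarrow> (nat \<Rightarrow> plane) \<Rightarrow> (plane \<Rightarrow> real^2^2) \<Rightarrow> real Matrix.mat" where
  "fem_matrix \<Omega> \<T> N B x \<sigma> =
     Matrix.mat N N (\<lambda>(j, k). if j < B then (if j = k then 1 else 0) else energy \<T> x \<sigma> \<Omega> j k)"

(* Meaningful only if invertible_mat (fem_matrix ...). *)
definition fem_dn_map ::
  "plane set \<Rightarrow> plane set set \<Rightarrow> nat \<Rightarrow> nat \<Rightarrow> (nat \<Rightarrow> plane) \<Rightarrow> (plane \<Rightarrow> real^2^2) \<Rightarrow>
   real Matrix.vec \<Rightarrow> real Matrix.vec" where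
  "fem_dn_map \<Omega> \<T> N B x \<sigma> =
     (\<lambda>f \<in> carrier_vec B.
        let u = (THE u. u \<in> carrier_vec N \<and>
                        fem_matrix \<Omega> \<T> N B x \<sigma> *\<^sub>v u = f @\<^sub>v 0\<^sub>v (N - B))
        in Matrix.vec B (\<lambda>j. \<Sum>k<N. energy \<T> x \<sigma> \<Omega> j k * vec_index u k))"

end

(* The finite element model only sees the numbers int sigma grad v_j . grad v_k, so it suffices that
   these are the same for sigma on the given triangulation and for the pushforward of S_{t beta}(sigma)
   on the deformed one.  Off the diagonal, S_{t beta} adds +t beta(e) and -t beta(e) to the energies of
   the two triangles at an interior edge e, which cancel in the sum; the diagonal follows because the
   hat functions add up to 1.  The pushforward preserves the energy of each triangle by the change of
   variables formula.  Since the displacement t w vanishes on the boundary, its extension by 0 to the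
   plane has a small Lipschitz constant, so that the identity plus the displacement is a bijection of
   the plane fixing the complement of the polygon.  Existence in the definition of S_beta rests on the
   rank one matrices (p - q)(p - q)^t of a side {p,q}: they change the energy of that side only. *)
theory Submission
  imports Defs "Jordan_Normal_Form.Determinant"
begin

no_notation vec_index (infixl "$" 100)
no_notation scalar_prod (infix "\<bullet>" 70)

section \<open>Barycentric coordinates of a triangle\<close>


text \<open>The displacement w vanishes at boundary vertices only, while its extension by 0 needs
  the interpolant of w to vanish on the whole frontier of \<Omega>. This is why so much is proved
  about sides: a point of a triangle outside the interior of the union is a vertex or lies on a side
  that no other triangle has, and the ends of such a side are limits of points outside the interior
  as well. The polygon enters through a few facts only: \<Omega> is open, connected, bounded,
  nonempty and equal to the interior of its closure; the last one identifies the frontier of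
  \<Omega> with that of the union of the triangles. The contraction argument on the whole plane
  gives injectivity and surjectivity at once, without comparing images of triangles pairwise. The
  bound on |t| comes from w and the triangulation, through a Lipschitz constant and the signs of
  determinants; it depends neither on \<beta> nor on \<sigma>. For such t the shifted conductivity
  may fail to be positive definite, so the second system is shown invertible by having the same
  matrix as the first, not by an energy argument.\<close>

text \<open>Twice the signed area of the triangle p, q, r; the sign of the same expression decides
  \<open>ccw_side\<close>.\<close>

definition orient :: "plane \<Rightarrow> plane \<Rightarrow> plane \<Rightarrow> real" where
  "orient p q r = (q$1 - p$1) * (r$2 - p$2) - (q$2 - p$2) * (r$1 - p$1)"

text \<open>The function \<open>orient a b\<close> is affine in its last argument and vanishes at a
  and b. If it also vanished at c it would vanish on the whole plane, but at a plus the quarter turn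
  of b - a its value is the squared length of b - a.\<close>

lemma orient_neq0:
  assumes "affine hull {a,b,c} = UNIV" "a \<noteq> b"
  shows "orient a b c \<noteq> 0"
proof
  assume o: "orient a b c = 0"
  define z :: plane where "z = a + vector [- (b$2 - a$2), b$1 - a$1]"
  have "z \<in> affine hull {a,b,c}" using assms by simp
  then obtain u v w where uvw: "z = u *\<^sub>R a + v *\<^sub>R b + w *\<^sub>R c" "u + v + w = 1"
    unfolding affine_hull_3 by blast
  have u: "u = 1 - v - w" using uvw by simp
  have "orient a b z = w * orient a b c"
    unfolding orient_def uvw(1) u by (simp add: algebra_simps)
  moreover have "orient a b z = (b$1 - a$1)^2 + (b$2 - a$2)^2"
    unfolding orient_def z_def by (simp add: algebra_simps power2_eq_square)
  ultimately have "(b$1 - a$1)^2 + (b$2 - a$2)^2 = 0" using o by simp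
  then have "b$1 = a$1" "b$2 = a$2" by (auto simp: sum_power2_eq_zero_iff)
  then show False using assms(2) by (simp add: Finite_Cartesian_Product.vec_eq_iff forall_2)
qed

lemma simplex2_vertices:
  assumes "2 simplex T"
  shows "card (tri_vertices T) = 3" "convex hull (tri_vertices T) = T"
    "affine hull (tri_vertices T) = UNIV" "finite (tri_vertices T)"
proof -
  obtain C where C: "\<not> affine_dependent C" "int (card C) = 3" "T = convex hull C"
    using assms by (auto simp: simplex_def)
  then have *: "tri_vertices T = C"
    by (auto simp: tri_vertices_def extreme_point_of_convex_hull_affine_independent)
  show "card (tri_vertices T) = 3" "convex hull (tri_vertices T) = T" using C * by auto
  show "affine hull (tri_vertices T) = UNIV"
    unfolding * by (rule affine_independent_span_eq) (use C in auto)
  show "finite (tri_vertices T)" using C * aff_independent_finite by auto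
qed

text \<open>The gradient of the barycentric coordinate of p. The value 0 at points that are not
  vertices of T makes it the gradient on T of the hat function of any vertex of the triangulation,
  so that sums may run over all labels.\<close>

definition bary_grad :: "plane set \<Rightarrow> plane \<Rightarrow> plane" where
  "bary_grad T p = (if p \<in> tri_vertices T
     then SOME d. \<forall>q \<in> tri_vertices T - {p}. d \<bullet> (q - p) = -1 else 0)"

definition bary :: "plane set \<Rightarrow> plane \<Rightarrow> plane \<Rightarrow> real" where
  "bary T p z = (if p \<in> tri_vertices T then 1 + bary_grad T p \<bullet> (z - p) else 0)"

lemma simplex2_obtain:
  assumes "2 simplex T" "p \<in> tri_vertices T"
  obtains q r where "tri_vertices T = {p,q,r}" "p \<noteq> q" "p \<noteq> r" "q \<noteq> r" "orient p q r \<noteq> 0"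
proof -
  have "card (tri_vertices T - {p}) = 2" using simplex2_vertices[OF assms(1)] assms(2) by simp
  then obtain q r where qr: "tri_vertices T - {p} = {q,r}" "q \<noteq> r" by (auto simp: card_2_iff)
  then have "tri_vertices T = {p,q,r}" "p \<noteq> q" "p \<noteq> r" using assms(2) by auto
  with qr show ?thesis using that orient_neq0 simplex2_vertices(3)[OF assms(1)] by metis
qed

lemma bary_grad_vertex:
  assumes T: "2 simplex T" and p: "p \<in> tri_vertices T" and q: "q \<in> tri_vertices T" "q \<noteq> p"
  shows "bary_grad T p \<bullet> (q - p) = -1"
proof -
  obtain b c where bc: "tri_vertices T = {p,b,c}" and o: "orient p b c \<noteq> 0"
    using simplex2_obtain[OF T p] by metis
  \<comment> \<open>A normal to the side opposite p, divided by twice the signed area so that the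
    coordinate drops by 1 from p to that side; this witness makes the choice in
    \<open>bary_grad\<close> meaningful.\<close>
  define d :: plane where "d = (1 / orient p b c) *\<^sub>R vector [(b$2 - p$2) - (c$2 - p$2), (c$1 - p$1) - (b$1 - p$1)]"
  have "vector [(b$2 - p$2) - (c$2 - p$2), (c$1 - p$1) - (b$1 - p$1)] \<bullet> (b - p) = - orient p b c"
    unfolding inner_vec_def sum_2 by (simp add: orient_def algebra_simps)
  moreover have "vector [(b$2 - p$2) - (c$2 - p$2), (c$1 - p$1) - (b$1 - p$1)] \<bullet> (c - p) = - orient p b c"
    unfolding inner_vec_def sum_2 by (simp add: orient_def algebra_simps)
  ultimately have "\<forall>q \<in> tri_vertices T - {p}. d \<bullet> (q - p) = -1" using o bc by (auto simp: d_def)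
  then have "\<forall>q \<in> tri_vertices T - {p}. bary_grad T p \<bullet> (q - p) = -1"
    using someI[of "\<lambda>d. \<forall>q \<in> tri_vertices T - {p}. d \<bullet> (q - p) = -1" d] p
    by (simp add: bary_grad_def)
  then show ?thesis using q by auto
qed

lemma bary_vertex:
  assumes "2 simplex T" "p \<in> tri_vertices T" "q \<in> tri_vertices T"
  shows "bary T p q = (if p = q then 1 else 0)"
  using bary_grad_vertex[OF assms] assms by (auto simp: bary_def)

lemma bary_diff:
  "p \<in> tri_vertices T \<Longrightarrow> bary T p z - bary T p y = bary_grad T p \<bullet> (z - y)"
  by (simp add: bary_def inner_diff)

lemma bary_affine:
  assumes "finite I" "(\<Sum>i\<in>I. c i) = 1"
  shows "bary T p (\<Sum>i\<in>I. c i *\<^sub>R z i) = (\<Sum>i\<in>I. c i * bary T p (z i))"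
proof (cases "p \<in> tri_vertices T")
  case True
  have "(\<Sum>i\<in>I. c i *\<^sub>R z i) - p = (\<Sum>i\<in>I. c i *\<^sub>R (z i - p))"
    using assms by (simp add: scaleR_diff_right sum_subtractf flip: scaleR_left.sum)
  then have "bary T p (\<Sum>i\<in>I. c i *\<^sub>R z i) = (\<Sum>i\<in>I. c i) + (\<Sum>i\<in>I. c i * (bary_grad T p \<bullet> (z i - p)))"
    using True assms by (simp add: bary_def inner_sum_right)
  then show ?thesis using True
    by (simp add: bary_def distrib_left sum.distrib)
qed (simp add: bary_def)

text \<open>The vertices span the plane affinely, so z has some affine coordinates u; since
  \<open>bary T p\<close> is affine and is 1 at p and 0 at the other vertices, it must pick out u
  p.\<close>

lemma bary_combination:
  assumes T: "2 simplex T"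
  shows "(\<Sum>p\<in>tri_vertices T. bary T p z) = 1"
    "(\<Sum>p\<in>tri_vertices T. bary T p z *\<^sub>R p) = z"
proof -
  note V = simplex2_vertices[OF T]
  have "z \<in> affine hull (tri_vertices T)" using V by simp
  then obtain u where u: "sum u (tri_vertices T) = 1" "(\<Sum>v\<in>tri_vertices T. u v *\<^sub>R v) = z"
    using affine_hull_finite[OF V(4)] by auto
  have "bary T p z = u p" if "p \<in> tri_vertices T" for p
  proof -
    have "bary T p z = (\<Sum>v\<in>tri_vertices T. u v * bary T p v)"
      using bary_affine[OF V(4) u(1), of T p "\<lambda>v. v"] u(2) by simp
    also have "\<dots> = (\<Sum>v\<in>tri_vertices T. if p = v then u p else 0)"
      by (intro sum.cong) (auto simp: bary_vertex[OF T that])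
    finally show ?thesis using that V(4) by simp
  qed
  then show "(\<Sum>p\<in>tri_vertices T. bary T p z) = 1"
    "(\<Sum>p\<in>tri_vertices T. bary T p z *\<^sub>R p) = z" using u by auto
qed

lemma bary_unique:
  assumes T: "2 simplex T" and "sum u (tri_vertices T) = 1" and "p \<in> tri_vertices T"
  shows "bary T p (\<Sum>v\<in>tri_vertices T. u v *\<^sub>R v) = u p"
proof -
  note V = simplex2_vertices[OF T]
  have "bary T p (\<Sum>v\<in>tri_vertices T. u v *\<^sub>R v) = (\<Sum>v\<in>tri_vertices T. u v * bary T p v)"
    using bary_affine[OF V(4) assms(2)] .
  also have "\<dots> = (\<Sum>v\<in>tri_vertices T. if p = v then u p else 0)"
    by (intro sum.cong) (auto simp: bary_vertex[OF T assms(3)])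
  finally show ?thesis using assms V(4) by simp
qed

lemma simplex2_eq_bary:
  assumes T: "2 simplex T"
  shows "z \<in> T \<longleftrightarrow> (\<forall>p\<in>tri_vertices T. 0 \<le> bary T p z)"
proof
  note V = simplex2_vertices[OF T]
  assume "z \<in> T"
  then have "z \<in> convex hull (tri_vertices T)" using V(2) by simp
  then obtain u where u: "\<forall>x\<in>tri_vertices T. 0 \<le> u x" "sum u (tri_vertices T) = 1" 
      "(\<Sum>v\<in>tri_vertices T. u v *\<^sub>R v) = z"
    unfolding convex_hull_finite[OF V(4)] by blast
  then show "\<forall>p\<in>tri_vertices T. 0 \<le> bary T p z" using bary_unique[OF T u(2)] by auto
next
  note V = simplex2_vertices[OF T]
  assume "\<forall>p\<in>tri_vertices T. 0 \<le> bary T p z"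
  then have "z \<in> convex hull (tri_vertices T)"
    unfolding convex_hull_finite[OF V(4)]
    by (intro CollectI exI[of _ "\<lambda>p. bary T p z"]) (simp add: bary_combination[OF T, of z])
  then show "z \<in> T" using V(2) by simp
qed

lemma continuous_on_bary [continuous_intros]: "continuous_on S f \<Longrightarrow> continuous_on S (\<lambda>z. bary T p (f z))"
  unfolding bary_def by (cases "p \<in> tri_vertices T") (auto intro!: continuous_intros)

lemma bary_grad_nonzero:
  assumes T: "2 simplex T" and "p \<in> tri_vertices T"
  shows "bary_grad T p \<noteq> 0"
proof -
  obtain q where "q \<in> tri_vertices T" "q \<noteq> p" using simplex2_obtain[OF assms] by (metis insertCI)
  then have "bary_grad T p \<bullet> (q - p) = -1" using bary_grad_vertex[OF assms] by blast
  then show ?thesis by auto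
qed

lemma interior_simplex2_eq_bary:
  assumes T: "2 simplex T"
  shows "z \<in> interior T \<longleftrightarrow> (\<forall>p\<in>tri_vertices T. 0 < bary T p z)"
proof
  assume z: "z \<in> interior T"
  show "\<forall>p\<in>tri_vertices T. 0 < bary T p z"
  proof (rule ccontr)
    assume "\<not> ?thesis"
    then obtain p where p: "p \<in> tri_vertices T" "bary T p z \<le> 0" by force
    obtain e where e: "e > 0" "cball z e \<subseteq> T" using z mem_interior_cball by blast
    define g where "g = bary_grad T p"
    have g: "g \<noteq> 0" unfolding g_def by (rule bary_grad_nonzero[OF T p(1)])
    \<comment> \<open>A step of length e against the gradient stays in the ball but strictly lowers
      a coordinate that was already at most 0.\<close>
    have "z - (e / norm g) *\<^sub>R g \<in> T" using e g by (intro subsetD[OF e(2)]) (simp add: dist_norm)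
    then have "0 \<le> bary T p (z - (e / norm g) *\<^sub>R g)" using simplex2_eq_bary[OF T] p by blast
    also have "\<dots> = bary T p z - (e / norm g) * (g \<bullet> g)"
      using p(1) by (simp add: bary_def inner_diff g_def)
    also have "\<dots> < 0" using p(2) e g by (intro le_less_trans[OF diff_right_mono[OF p(2)]]) simp
    finally show False by simp
  qed
next
  assume z: "\<forall>p\<in>tri_vertices T. 0 < bary T p z"
  have "open (\<Inter>p\<in>tri_vertices T. {z. 0 < bary T p z})"
    using simplex2_vertices(4)[OF T]
    by (intro open_INT) (auto intro!: open_Collect_less continuous_on_bary continuous_on_const continuous_on_id)
  moreover have "(\<Inter>p\<in>tri_vertices T. {z. 0 < bary T p z}) \<subseteq> T"
    unfolding simplex2_eq_bary[OF T] subset_iff by (auto intro: less_imp_le)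
  moreover have "z \<in> (\<Inter>p\<in>tri_vertices T. {z. 0 < bary T p z})" using z by simp
  ultimately show "z \<in> interior T" by (blast intro: interiorI)
qed

text \<open>The gradient of the identity that the barycentric coordinates add up to 1.\<close>

lemma sum_bary_grad:
  assumes T: "2 simplex T"
  shows "(\<Sum>p\<in>tri_vertices T. bary_grad T p) = 0" 
proof -
  have *: "(\<Sum>p\<in>tri_vertices T. bary_grad T p) \<bullet> s = 0" for s
  proof -
    have "(\<Sum>p\<in>tri_vertices T. bary_grad T p) \<bullet> s
        = (\<Sum>p\<in>tri_vertices T. bary T p s - bary T p 0)"
      unfolding inner_sum_left by (intro sum.cong) (auto simp: bary_diff)
    also have "\<dots> = 0" unfolding sum_subtractf bary_combination(1)[OF T] by simp
    finally show ?thesis .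
  qed
  show ?thesis using *[of "\<Sum>p\<in>tri_vertices T. bary_grad T p"] unfolding inner_eq_zero_iff .
qed

text \<open>The linear part of the identity that z is the barycentric combination of the vertices.
  In particular only 0 is orthogonal to all gradients.\<close>

lemma bary_grad_span:
  assumes T: "2 simplex T"
  shows "(\<Sum>p\<in>tri_vertices T. (bary_grad T p \<bullet> y) *\<^sub>R p) = y"
proof -
  have "(\<Sum>p\<in>tri_vertices T. (bary_grad T p \<bullet> y) *\<^sub>R p) = 
     (\<Sum>p\<in>tri_vertices T. bary T p y *\<^sub>R p - bary T p 0 *\<^sub>R p)"
    by (intro sum.cong) (auto simp: bary_diff simp flip: scaleR_diff_left)
  then show ?thesis unfolding sum_subtractf bary_combination(2)[OF T] by simp
qed

lemma simplex2_props:
  fixes T :: "plane set"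
  assumes T: "2 simplex T"
  shows "compact T" "convex T" "closed T" "closure (interior T) = T" "interior T \<noteq> {}"
proof -
  note V = simplex2_vertices[OF T]
  show "compact T" using V finite_imp_compact_convex_hull by metis
  then show "closed T" by (rule compact_imp_closed)
  show "convex T" using V convex_convex_hull by metis
  have "(\<Sum>p\<in>tri_vertices T. (1/3::real) *\<^sub>R p) \<in> interior T"
    unfolding interior_simplex2_eq_bary[OF T]
  proof
    fix p assume "p \<in> tri_vertices T"
    then show "0 < bary T p (\<Sum>p\<in>tri_vertices T. (1/3::real) *\<^sub>R p)"
      using bary_unique[OF T, of "\<lambda>_. 1/3" p] V by simp
  qed
  then show ne: "interior T \<noteq> {}" by auto
  show "closure (interior T) = T"
    using convex_closure_interior[OF \<open>convex T\<close> ne] \<open>closed T\<close> by simp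
qed

section \<open>Piecewise affine interpolation\<close>


text \<open>Defined by the affine formula on the whole plane and not only on T, so that linearity,
  continuity and Lipschitz bounds hold on any set.\<close>

definition interp :: "plane set \<Rightarrow> (plane \<Rightarrow> 'b::real_normed_vector) \<Rightarrow> plane \<Rightarrow> 'b" where
  "interp T g z = (\<Sum>p\<in>tri_vertices T. bary T p z *\<^sub>R g p)"

lemma interp_vertex:
  assumes T: "2 simplex T" and q: "q \<in> tri_vertices T"
  shows "interp T g q = g q"
proof -
  have "interp T g q = (\<Sum>p\<in>tri_vertices T. if p = q then g q else 0)"
    unfolding interp_def by (intro sum.cong) (auto simp: bary_vertex[OF T _ q])
  then show ?thesis using simplex2_vertices(4)[OF T] q by simp
qed

lemma interp_diff:
  "interp T g y - interp T g z = (\<Sum>p\<in>tri_vertices T. (bary_grad T p \<bullet> (y - z)) *\<^sub>R g p)"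
  unfolding interp_def sum_subtractf[symmetric]
  by (intro sum.cong) (auto simp: bary_diff simp flip: scaleR_diff_left)

lemma linear_interp: "linear (\<lambda>y. \<Sum>p\<in>tri_vertices T. (bary_grad T p \<bullet> y) *\<^sub>R g p)"
  by (intro linearI)
    (simp_all add: inner_add_right scaleR_add_left sum.distrib scaleR_sum_right)

lemma interp_eq_linear:
  "interp T g z = (\<Sum>p\<in>tri_vertices T. (bary_grad T p \<bullet> z) *\<^sub>R g p) + interp T g 0"
  using interp_diff[of T g z 0] by (simp add: algebra_simps)

lemma affine_map_on_interp: "affine_map_on S (interp T g)"
  unfolding affine_map_on_def 
  by (intro exI conjI ballI, rule linear_interp, rule interp_eq_linear)

lemma tri_vertices_subset: "tri_vertices T \<subseteq> T"
  by (auto simp: tri_vertices_def extreme_point_of_def)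

lemma affine_map_on_eq_interp:
  assumes T: "2 simplex T" and h: "affine_map_on T h" and z: "z \<in> T"
  shows "h z = interp T h z"
proof -
  obtain l c where l: "linear l" and hl: "\<And>p. p \<in> T \<Longrightarrow> h p = l p + c"
    using h unfolding affine_map_on_def by blast
  have "h z = l (\<Sum>p\<in>tri_vertices T. bary T p z *\<^sub>R p) + (\<Sum>p\<in>tri_vertices T. bary T p z) *\<^sub>R c"
    using hl[OF z] bary_combination[OF T, of z] by simp
  also have "\<dots> = (\<Sum>p\<in>tri_vertices T. bary T p z *\<^sub>R (l p + c))"
    by (simp add: linear_sum[OF l] linear_scale[OF l] scaleR_add_right sum.distrib scaleR_left.sum)
  also have "\<dots> = interp T h z"
    unfolding interp_def using hl subsetD[OF tri_vertices_subset[of T]] by (intro sum.cong) auto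
  finally show ?thesis .
qed

lemma interp_cong:
  "(\<And>p. p \<in> tri_vertices T \<Longrightarrow> g p = h p) \<Longrightarrow> interp T g z = interp T h z"
  unfolding interp_def by (intro sum.cong) auto

lemma continuous_on_interp: "continuous_on S (interp T g)"
  unfolding interp_def by (intro continuous_intros)

lemma interp_affine2:
  assumes "u + v = 1"
  shows "interp T g (u *\<^sub>R x + v *\<^sub>R y) = u *\<^sub>R interp T g x + v *\<^sub>R interp T g y"
proof -
  have v: "v = 1 - u" using assms by simp
  have "u *\<^sub>R x + v *\<^sub>R y - y = u *\<^sub>R (x - y)" by (simp add: v algebra_simps)
  then have "interp T g (u *\<^sub>R x + v *\<^sub>R y) - interp T g y = u *\<^sub>R (interp T g x - interp T g y)"
    unfolding interp_diff by (simp add: scaleR_sum_right)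
  then show ?thesis by (simp add: v algebra_simps)
qed

lemma triangulation_simplex: "triangulation_of \<T> S \<Longrightarrow> T \<in> \<T> \<Longrightarrow> 2 simplex T"
  by (simp add: triangulation_of_def)

lemma triangulation_Union: "triangulation_of \<T> S \<Longrightarrow> \<Union>\<T> = S"
  and triangulation_finite: "triangulation_of \<T> S \<Longrightarrow> finite \<T>"
  by (simp_all add: triangulation_of_def)

lemma tri_side_subset: "e \<in> tri_sides T \<Longrightarrow> e \<subseteq> tri_vertices T"
  by (auto simp: tri_sides_def)

text \<open>Merges the three cases of the definition: e is empty, a common vertex, or a common
  side.\<close>

lemma triangulation_inter:
  assumes "triangulation_of \<T> S" "T \<in> \<T>" "T' \<in> \<T>" "T \<noteq> T'"
  obtains e where "e \<subseteq> tri_vertices T \<inter> tri_vertices T'" "finite e" "card e \<le> 2"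
    "T \<inter> T' = convex hull e"
proof -
  have "\<forall>T\<in>\<T>. \<forall>T'\<in>\<T>. T \<noteq> T' \<longrightarrow> T \<inter> T' = {} \<or>
        (\<exists>p \<in> tri_vertices T \<inter> tri_vertices T'. T \<inter> T' = {p}) \<or>
        (\<exists>e \<in> tri_sides T \<inter> tri_sides T'. T \<inter> T' = convex hull e)"
    using assms(1) unfolding triangulation_of_def by (elim conjE)
  note this[rule_format, OF assms(2-4)]
  then consider "T \<inter> T' = {}" | p where "p \<in> tri_vertices T \<inter> tri_vertices T'" "T \<inter> T' = {p}"
    | e where "e \<in> tri_sides T \<inter> tri_sides T'" "T \<inter> T' = convex hull e"
    by blast
  then show ?thesis
  proof cases
    case 1
    show ?thesis by (rule that[of "{}"]) (use 1 in auto)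
  next
    case 2
    show ?thesis by (rule that[of "{p}"]) (use 2 in auto)
  next
    case 3
    have "e \<subseteq> tri_vertices T \<inter> tri_vertices T'" using 3(1) by (simp add: tri_side_subset)
    moreover have "finite e \<and> card e \<le> 2"
    proof -
      obtain p q where "e = {p,q}" using 3 unfolding tri_sides_def by blast
      then show ?thesis by (cases "p = q") auto
    qed
    ultimately show ?thesis using that[of e] 3(2) by simp
  qed
qed

text \<open>The hull of at most two points has empty interior in the plane.\<close>

lemma disjoint_interiors:
  assumes "triangulation_of \<T> S" "T \<in> \<T>" "T' \<in> \<T>" "T \<noteq> T'"
  shows "interior T \<inter> interior T' = {}"
proof -
  obtain e where "finite e" "card e \<le> 2" "T \<inter> T' = convex hull e"
    using triangulation_inter[OF assms] by metis
  then show ?thesis using empty_interior_convex_hull[of e] by (simp flip: interior_Int)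
qed

text \<open>The set where two affine maps coincide is convex; it contains the common vertices, hence
  their hull, which is the intersection of the triangles.\<close>

lemma interp_agree:
  assumes "triangulation_of \<T> S" "T \<in> \<T>" "T' \<in> \<T>" "z \<in> T" "z \<in> T'"
  shows "interp T g z = interp T' g z"
proof (cases "T = T'")
  case False
  obtain e where e: "e \<subseteq> tri_vertices T \<inter> tri_vertices T'" "T \<inter> T' = convex hull e"
    using triangulation_inter[OF assms(1-3) False] by metis
  have "convex {z. interp T g z = interp T' g z}"
    by (auto simp: convex_def interp_affine2)
  moreover have "e \<subseteq> {z. interp T g z = interp T' g z}"
  proof
    fix v assume "v \<in> e"
    then have "v \<in> tri_vertices T" "v \<in> tri_vertices T'" using e(1) by auto
    then show "v \<in> {z. interp T g z = interp T' g z}"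
      by (simp add: interp_vertex triangulation_simplex[OF assms(1)] assms(2,3))
  qed
  ultimately have "convex hull e \<subseteq> {z. interp T g z = interp T' g z}" by (rule hull_minimal[rotated])
  then show ?thesis using e assms by auto
qed simp

lemma pl_extension_unique:
  assumes tri: "triangulation_of \<T> S" and "T \<in> \<T>" "z \<in> T"
    and "\<forall>T\<in>\<T>. affine_map_on T h" "\<forall>p\<in>vertices \<T>. h p = g p"
  shows "h z = interp T g z"
proof -
  have "h z = interp T h z" using affine_map_on_eq_interp triangulation_simplex[OF tri] assms by blast
  also have "\<dots> = interp T g z" using assms by (intro interp_cong) (auto simp: vertices_def)
  finally show ?thesis .
qed

text \<open>Replaces the \<open>THE\<close> by the explicit interpolant. Existence is gluing over
  finitely many closed triangles; uniqueness holds because an affine map on a triangle is determined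
  at the vertices and the values off the union are fixed by \<open>extensional\<close>.\<close>

lemma pl_extension:
  fixes g :: "plane \<Rightarrow> 'b::real_normed_vector"
  assumes tri: "triangulation_of \<T> S"
  shows "continuous_on S (pl_extension \<T> g)"
    and "T \<in> \<T> \<Longrightarrow> affine_map_on T (pl_extension \<T> g)"
    and "T \<in> \<T> \<Longrightarrow> z \<in> T \<Longrightarrow> pl_extension \<T> g z = interp T g z"
proof -
  let ?P = "\<lambda>h. continuous_on (\<Union>\<T>) h \<and> (\<forall>T\<in>\<T>. affine_map_on T h) \<and>
             (\<forall>p\<in>vertices \<T>. h p = g p) \<and> h \<in> extensional (\<Union>\<T>)"
  \<comment> \<open>By \<open>interp_agree\<close> the choice of a triangle containing z does not
    affect the value.\<close>
  define h where "h z = (if z \<in> \<Union>\<T> then interp (SOME T. T \<in> \<T> \<and> z \<in> T) g z else undefined)" for z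
  have h: "h z = interp T g z" if "T \<in> \<T>" "z \<in> T" for T z
  proof -
    have "(SOME T. T \<in> \<T> \<and> z \<in> T) \<in> \<T> \<and> z \<in> (SOME T. T \<in> \<T> \<and> z \<in> T)"
      by (rule someI[of "\<lambda>T. T \<in> \<T> \<and> z \<in> T" T]) (use that in auto)
    then show ?thesis using that interp_agree[OF tri] by (auto simp: h_def)
  qed
  have "?P h"
  proof (intro conjI ballI)
    have "continuous_on (\<Union>T\<in>\<T>. T) h"
    proof (intro continuous_on_closed_Union)
      fix T assume T: "T \<in> \<T>"
      show "closed T" using simplex2_props(3)[OF triangulation_simplex[OF tri T]] .
      show "continuous_on T h"
        using continuous_on_interp[of T T g] h[OF T] by (simp cong: continuous_on_cong)
    qed (use tri in \<open>simp add: triangulation_of_def\<close>)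
    then show "continuous_on (\<Union>\<T>) h" by simp
    show "affine_map_on T h" if "T \<in> \<T>" for T
      using affine_map_on_interp[of T T g] h that by (simp add: affine_map_on_def)
    show "h p = g p" if "p \<in> vertices \<T>" for p
    proof -
      obtain T where T: "T \<in> \<T>" "p \<in> tri_vertices T" using \<open>p \<in> vertices \<T>\<close> unfolding vertices_def by blast
      then have "h p = interp T g p" using h tri_vertices_subset by blast
      then show ?thesis using interp_vertex[OF triangulation_simplex[OF tri T(1)] T(2)] by simp
    qed
    show "h \<in> extensional (\<Union>\<T>)" by (auto simp: h_def extensional_def)
  qed
  moreover have "k = h" if "?P k" for k
  proof
    fix z
    show "k z = h z"
    proof (cases "z \<in> \<Union>\<T>")
      case True
      then show ?thesis using pl_extension_unique[OF tri, of _ z k g] that h by auto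
    next
      case False
      then show ?thesis using that \<open>?P h\<close> unfolding extensional_def by simp
    qed
  qed
  ultimately have eq: "pl_extension \<T> g = h"
    unfolding pl_extension_def by (rule the_equality)
  show "continuous_on S (pl_extension \<T> g)"
    using \<open>?P h\<close> tri unfolding eq triangulation_of_def by auto
  show "T \<in> \<T> \<Longrightarrow> affine_map_on T (pl_extension \<T> g)"
    using \<open>?P h\<close> unfolding eq by blast
  show "T \<in> \<T> \<Longrightarrow> z \<in> T \<Longrightarrow> pl_extension \<T> g z = interp T g z"
    unfolding eq by (rule h)
qed

section \<open>Position of two triangles with a common side\<close>

lemma tri_side_obtain:
  assumes T: "2 simplex T" and "{p,q} \<in> tri_sides T"
  obtains r where "tri_vertices T = {p,q,r}" "p \<noteq> q" "p \<noteq> r" "q \<noteq> r" "orient p q r \<noteq> 0"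
proof -
  have pq: "p \<in> tri_vertices T" "q \<in> tri_vertices T" "p \<noteq> q"
    using assms(2) by (auto simp: tri_sides_def doubleton_eq_iff)
  obtain a b where ab: "tri_vertices T = {p,a,b}" "p \<noteq> a" "p \<noteq> b" "a \<noteq> b"
    using simplex2_obtain[OF T pq(1)] by metis
  then have "q = a \<or> q = b" using pq by auto
  then obtain r where r: "tri_vertices T = {p,q,r}" "p \<noteq> r" "q \<noteq> r" using ab by auto
  then have "orient p q r \<noteq> 0" using orient_neq0[of p q r] pq(3) simplex2_vertices(3)[OF T] by simp
  with r pq show ?thesis using that by blast
qed

text \<open>Both sides are affine in z, vanish at p and q and agree at r. The left side does not
  mention r, so the third coordinates of two triangles with side {p, q} become comparable.\<close>

lemma bary_orient:
  assumes T: "2 simplex T" and V: "tri_vertices T = {p,q,r}" "p \<noteq> q" "p \<noteq> r" "q \<noteq> r"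
  shows "orient p q z = bary T r z * orient p q r"
proof -
  have 1: "bary T p z = 1 - bary T q z - bary T r z"
    using bary_combination(1)[OF T, of z] V by simp
  have 2: "z = bary T p z *\<^sub>R p + bary T q z *\<^sub>R q + bary T r z *\<^sub>R r"
    using bary_combination(2)[OF T, of z] V by (simp add: add.assoc)
  have *: "orient p q ((1 - b - c) *\<^sub>R p + b *\<^sub>R q + c *\<^sub>R r) = c * orient p q r" for b c
    by (simp add: orient_def algebra_simps)
  have "orient p q z = orient p q (bary T p z *\<^sub>R p + bary T q z *\<^sub>R q + bary T r z *\<^sub>R r)"
    by (rule arg_cong[OF 2])
  also have "\<dots> = bary T r z * orient p q r" unfolding 1 by (rule *)
  finally show ?thesis .
qed

text \<open>Were the third vertices on the same side of the line, points close to the midpoint of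
  the common side would be interior to both triangles.\<close>

lemma opposite_sides:
  assumes tri: "triangulation_of \<T> S" "T \<in> \<T>" "T' \<in> \<T>" "T \<noteq> T'"
    and V: "tri_vertices T = {p,q,r}" "tri_vertices T' = {p,q,r'}" "p \<noteq> q" "p \<noteq> r" "q \<noteq> r" "p \<noteq> r'" "q \<noteq> r'"
  shows "orient p q r * orient p q r' < 0"
proof (rule ccontr)
  assume neg: "\<not> orient p q r * orient p q r' < 0"
  note T = triangulation_simplex[OF tri(1,2)] and T' = triangulation_simplex[OF tri(1,3)]
  have "orient p q r \<noteq> 0" "orient p q r' \<noteq> 0"
    using orient_neq0 V simplex2_vertices(3)[OF T] simplex2_vertices(3)[OF T'] by auto
  then have pos: "orient p q r * orient p q r' > 0" 
    using neg by (simp add: order.order_iff_strict not_less)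
  \<comment> \<open>z goes from the midpoint of the side a short way towards r: it is interior to T
    for every \<epsilon> in (0,1), and for small \<epsilon> its coordinates at p and q with respect
    to T' stay close to 1/2.\<close>
  define m where "m = (1/2) *\<^sub>R p + (1/2) *\<^sub>R q"
  define z where "z \<epsilon> = (1 - \<epsilon>) *\<^sub>R m + \<epsilon> *\<^sub>R r" for \<epsilon> :: real
  have baff: "bary X v (a *\<^sub>R y + b *\<^sub>R y') = a * bary X v y + b * bary X v y'" if "a + b = 1" for X v a b y y'
    using bary_affine[of "{True,False}" "\<lambda>i. if i then a else b" X v "\<lambda>i. if i then y else y'"] that by simp
  have bm: "bary X v m = (bary X v p + bary X v q) / 2" for X v
    unfolding m_def by (subst baff) auto
  have bz: "bary X v (z \<epsilon>) = (1 - \<epsilon>) * bary X v m + \<epsilon> * bary X v r" for X v \<epsilon>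
    unfolding z_def by (subst baff) auto
  have ev: "\<forall>\<^sub>F \<epsilon> in at_right 0. bary T' v (z \<epsilon>) > 0" if "v \<in> {p,q}" for v
  proof -
    have "((\<lambda>\<epsilon>. bary T' v (z \<epsilon>)) \<longlongrightarrow> (1 - 0) * bary T' v m + 0 * bary T' v r) (at_right 0)"
      unfolding bz by (intro tendsto_intros)
    moreover have "bary T' v m = 1/2" using that V by (auto simp: bm bary_vertex[OF T'])
    ultimately show ?thesis using order_tendstoD(1)[of "\<lambda>\<epsilon>. bary T' v (z \<epsilon>)" "1/2" _ 0] by simp
  qed
  have "\<forall>\<^sub>F \<epsilon> in at_right (0::real). \<epsilon> \<in> {0<..<1}"
    by (rule eventually_at_right_real) simp
  then have "\<forall>\<^sub>F \<epsilon> in at_right 0. \<epsilon> \<in> {0<..<1} \<and> bary T' p (z \<epsilon>) > 0 \<and> bary T' q (z \<epsilon>) > 0"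
    using ev[of p] ev[of q] by (intro eventually_conj) auto
  then obtain \<epsilon> where \<epsilon>: "0 < \<epsilon>" "\<epsilon> < 1" "bary T' p (z \<epsilon>) > 0" "bary T' q (z \<epsilon>) > 0"
    using eventually_happens trivial_limit_at_right_real by (metis (no_types, lifting) greaterThanLessThan_iff)
  have "z \<epsilon> \<in> interior T"
    unfolding interior_simplex2_eq_bary[OF T] using V \<epsilon>(1,2) by (auto simp: bz bm bary_vertex[OF T])
  moreover have "bary T' r' (z \<epsilon>) > 0"
  proof -
    have "bary T r (z \<epsilon>) = \<epsilon>" using V by (auto simp: bz bm bary_vertex[OF T])
    then have "bary T' r' (z \<epsilon>) * orient p q r' = \<epsilon> * orient p q r"
      using bary_orient[OF T V(1,3,4,5)] bary_orient[OF T' V(2,3,6,7)] by metis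
    then have "bary T' r' (z \<epsilon>) * (orient p q r' * orient p q r') = \<epsilon> * (orient p q r * orient p q r')"
      by (metis mult.assoc)
    then have "0 < bary T' r' (z \<epsilon>) * (orient p q r' * orient p q r')"
      using mult_pos_pos[OF \<epsilon>(1) pos] by (simp only:)
    then show ?thesis by (metis mult_le_0_iff not_le zero_le_square)
  qed
  then have "z \<epsilon> \<in> interior T'"
    unfolding interior_simplex2_eq_bary[OF T'] using V \<epsilon> by auto
  ultimately show False using disjoint_interiors[OF tri] by blast
qed

section \<open>Edges of a triangulation\<close>


lemma ccw_side_iff:
  assumes T: "2 simplex T" and V: "tri_vertices T = {p,q,r}" "p \<noteq> q" "p \<noteq> r" "q \<noteq> r"
  shows "ccw_side T p q \<longleftrightarrow> orient p q r > 0" "ccw_side T q p \<longleftrightarrow> orient p q r < 0"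
proof -
  have s: "{p,q} \<in> tri_sides T" "{q,p} \<in> tri_sides T" unfolding tri_sides_def using V by blast+
  have "{p,q,r} = {p,q,s} \<longleftrightarrow> s = r" "{p,q,r} = {q,p,s} \<longleftrightarrow> s = r" for s using V by auto
  then show "ccw_side T p q \<longleftrightarrow> orient p q r > 0" "ccw_side T q p \<longleftrightarrow> orient p q r < 0"
    using s V(1) unfolding ccw_side_def orient_def by (auto simp: algebra_simps)
qed

lemma ccw_side_cases:
  assumes T: "2 simplex T" and "{p,q} \<in> tri_sides T"
  shows "ccw_side T p q \<longleftrightarrow> \<not> ccw_side T q p"
proof -
  obtain r where "tri_vertices T = {p,q,r}" "p \<noteq> q" "p \<noteq> r" "q \<noteq> r" "orient p q r \<noteq> 0"
    using tri_side_obtain[OF assms] .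
  then show ?thesis using ccw_side_iff[OF T] by auto
qed

lemma ccw_side_opposite:
  assumes tri: "triangulation_of \<T> S" "T \<in> \<T>" "T' \<in> \<T>" "T \<noteq> T'"
    and e: "{p,q} \<in> tri_sides T" "{p,q} \<in> tri_sides T'"
  shows "ccw_side T p q \<longleftrightarrow> ccw_side T' q p"
proof -
  note T = triangulation_simplex[OF tri(1,2)] and T' = triangulation_simplex[OF tri(1,3)]
  obtain r where r: "tri_vertices T = {p,q,r}" "p \<noteq> q" "p \<noteq> r" "q \<noteq> r" "orient p q r \<noteq> 0"
    using tri_side_obtain[OF T e(1)] .
  obtain r' where r': "tri_vertices T' = {p,q,r'}" "p \<noteq> q" "p \<noteq> r'" "q \<noteq> r'" "orient p q r' \<noteq> 0"
    using tri_side_obtain[OF T' e(2)] .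
  have "orient p q r * orient p q r' < 0"
    by (rule opposite_sides[OF tri r(1) r'(1)]) (use r r' in auto)
  then show ?thesis
    using ccw_side_iff[OF T r(1-4)] ccw_side_iff[OF T' r'(1-4)] by (auto simp: mult_less_0_iff)
qed

text \<open>Different triangles at a side lie on opposite sides of its line. As a line has two sides
  only, a third triangle would lie on the same side as one of the first two.\<close>

lemma triangles_at_edge:
  assumes tri: "triangulation_of \<T> S" and T: "T \<in> \<T>" "{p,q} \<in> tri_sides T"
  shows "{p,q} \<in> boundary_edges \<T> \<and> {T \<in> \<T>. {p,q} \<in> tri_sides T} = {T} \<or>
    {p,q} \<in> interior_edges \<T> \<and> (\<exists>T'\<in>\<T>. T' \<noteq> T \<and> {p,q} \<in> tri_sides T' \<and>
        {T \<in> \<T>. {p,q} \<in> tri_sides T} = {T,T'} \<and> (ccw_side T p q \<longleftrightarrow> ccw_side T' q p))"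
proof -
  have E: "{p,q} \<in> edges \<T>" using T by (auto simp: edges_def)
  show ?thesis
  proof (cases "\<exists>T'\<in>\<T>. T' \<noteq> T \<and> {p,q} \<in> tri_sides T'")
    case True
    then obtain T' where T': "T' \<in> \<T>" "T' \<noteq> T" "{p,q} \<in> tri_sides T'" by blast
    have opp: "ccw_side X p q \<longleftrightarrow> ccw_side Y q p"
      if "X \<in> \<T>" "Y \<in> \<T>" "X \<noteq> Y" "{p,q} \<in> tri_sides X" "{p,q} \<in> tri_sides Y" for X Y
      using ccw_side_opposite[OF tri that] .
    have cas: "ccw_side X p q \<longleftrightarrow> \<not> ccw_side X q p" if "X \<in> \<T>" "{p,q} \<in> tri_sides X" for X
      using ccw_side_cases[OF triangulation_simplex[OF tri that(1)] that(2)] .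
    have "X = T \<or> X = T'" if "X \<in> \<T>" "{p,q} \<in> tri_sides X" for X
      using opp[of X T] opp[of X T'] opp[of T T'] cas[of X] cas[of T] cas[of T'] T T' that by metis
    then have *: "{T \<in> \<T>. {p,q} \<in> tri_sides T} = {T,T'}" using T T' by auto
    then have "{p,q} \<in> interior_edges \<T>" using E T' by (simp add: interior_edges_def)
    then show ?thesis using * T' opp[of T T'] T by blast
  next
    case False
    then have *: "{T \<in> \<T>. {p,q} \<in> tri_sides T} = {T}" using T by auto
    then have "{p,q} \<in> boundary_edges \<T>" using E by (simp add: boundary_edges_def)
    then show ?thesis using * by blast
  qed
qed

section \<open>Points of triangles that are not interior to the union\<close>

text \<open>Near z the coordinates at p and q stay positive for both triangles, and since the third
  vertices lie on opposite sides of the line, the third coordinate is nonnegative for at least one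
  of them.\<close>

lemma edge_point_interior:
  assumes tri: "triangulation_of \<T> S" and T: "T \<in> \<T>" "T' \<in> \<T>" "T \<noteq> T'"
    and V: "tri_vertices T = {p,q,r}" "p \<noteq> q" "p \<noteq> r" "q \<noteq> r" and e: "{p,q} \<in> tri_sides T'"
    and z: "bary T p z > 0" "bary T q z > 0" "bary T r z = 0"
  shows "z \<in> interior S"
proof -
  note sT = triangulation_simplex[OF tri T(1)] and sT' = triangulation_simplex[OF tri T(2)]
  obtain r' where r': "tri_vertices T' = {p,q,r'}" "p \<noteq> q" "p \<noteq> r'" "q \<noteq> r'" "orient p q r' \<noteq> 0"
    using tri_side_obtain[OF sT' e] .
  have opp: "orient p q r * orient p q r' < 0"
    by (rule opposite_sides[OF tri T V(1) r'(1)]) (use V r' in auto)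
  define U where "U = {z. bary T p z > 0} \<inter> {z. bary T q z > 0} \<inter> {z. bary T' p z > 0} \<inter> {z. bary T' q z > 0}"
  have "open U" unfolding U_def
    by (intro open_Int open_Collect_less continuous_on_bary continuous_on_const continuous_on_id)
  moreover have "z \<in> U"
  proof -
    have "z = bary T p z *\<^sub>R p + bary T q z *\<^sub>R q" "bary T p z + bary T q z = 1"
      using bary_combination[OF sT, of z] V z(3) by simp_all
    then have "bary T' v z = bary T p z * bary T' v p + bary T q z * bary T' v q" for v
      using bary_affine[of "{True,False}" "\<lambda>i. if i then bary T p z else bary T q z" T' v "\<lambda>i. if i then p else q"]
      by simp
    then show ?thesis using z r' unfolding U_def by (simp add: bary_vertex[OF sT'])
  qed
  moreover have "U \<subseteq> S"
  proof
    fix y assume y: "y \<in> U"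
    have "bary T r y * orient p q r = bary T' r' y * orient p q r'"
      using bary_orient[OF sT V] bary_orient[OF sT' r'(1-4)] by metis
    then have "bary T r y \<ge> 0 \<or> bary T' r' y \<ge> 0"
      using opp by (smt (verit) mult_less_0_iff mult_neg_neg mult_neg_pos)
    then have "y \<in> T \<or> y \<in> T'"
      unfolding simplex2_eq_bary[OF sT] simplex2_eq_bary[OF sT'] using y V(1) r'(1)
      by (auto simp: U_def)
    then show "y \<in> S" using tri T by (auto simp: triangulation_of_def)
  qed
  ultimately show ?thesis by (blast intro: interiorI)
qed

lemma bary_zero_hull:
  assumes T: "2 simplex T" and e: "e \<subseteq> tri_vertices T" and z: "z \<in> convex hull e" and p: "p \<notin> e"
  shows "bary T p z = 0"
proof (cases "p \<in> tri_vertices T")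
  case True
  have eq: "{z. bary T p z = 0} = {z. bary_grad T p \<bullet> z = bary_grad T p \<bullet> p - 1}"
    using True by (auto simp: bary_def inner_diff)
  have "convex {z. bary T p z = 0}" unfolding eq by (rule convex_hyperplane)
  moreover have "e \<subseteq> {z. bary T p z = 0}" using bary_vertex[OF T True] e p by auto
  ultimately show ?thesis using z hull_minimal[of e _ convex] by blast
qed (simp add: bary_def)

text \<open>A single noninterior point on the open side shows, by
  \<open>edge_point_interior\<close>, that no other triangle has this side. Then no point of the
  open side is interior to S, and the ends are limits of such points.\<close>

lemma frontier_edge:
  assumes tri: "triangulation_of \<T> S" and T: "T \<in> \<T>"
    and V: "tri_vertices T = {p,q,r}" "p \<noteq> q" "p \<noteq> r" "q \<noteq> r"
    and z: "bary T p z > 0" "bary T q z > 0" "bary T r z = 0" "z \<notin> interior S"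
  shows "p \<in> closure (S - interior S)" "q \<in> closure (S - interior S)"
proof -
  note sT = triangulation_simplex[OF tri T(1)]
  have S: "S = \<Union>\<T>" "finite \<T>" using tri by (auto simp: triangulation_of_def)
  have only: "{p,q} \<notin> tri_sides T'" if "T' \<in> \<T>" "T' \<noteq> T" for T'
    using edge_point_interior[OF tri T that(1) _ V _ z(1-3)] z(4) that(2) by metis
  have "y \<in> S - interior S" if y: "bary T p y > 0" "bary T q y > 0" "bary T r y = 0" for y
  proof -
    have yT: "y \<in> T" unfolding simplex2_eq_bary[OF sT] using y V(1) by simp
    have notin: "y \<notin> T'" if T': "T' \<in> \<T>" "T' \<noteq> T" for T'
    proof
      assume "y \<in> T'"
      obtain e where e: "e \<subseteq> tri_vertices T \<inter> tri_vertices T'" "T \<inter> T' = convex hull e"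
        using triangulation_inter[OF tri T T'(1)] T'(2) by metis
      have "y \<in> convex hull e" using \<open>y \<in> T'\<close> yT e by blast
      \<comment> \<open>The coordinates of y at p and q are positive, so a hull of vertices of T
        that contains y must use both p and q.\<close>
      then have "p \<in> e" "q \<in> e" using bary_zero_hull[OF sT, of e y] e(1) y by force+
      then have "{p,q} \<in> tri_sides T'" using e(1) V(2) unfolding tri_sides_def by blast
      then show False using only T' by blast
    qed
    have "y \<notin> interior S"
    proof
      assume yS: "y \<in> interior S"
      \<comment> \<open>A neighbourhood of y that avoids all other triangles; it would lie in T and
        make y interior to T, although the coordinate at r is 0.\<close>
      define U where "U = interior S \<inter> - \<Union>(\<T> - {T})"
      have "closed (\<Union>(\<T> - {T}))"
        using S(2) simplex2_props(3) triangulation_simplex[OF tri] by (intro closed_Union) auto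
      then have "open U" unfolding U_def by (intro open_Int) auto
      moreover have "U \<subseteq> T" unfolding U_def using interior_subset[of S] S by blast
      moreover have "y \<in> U" unfolding U_def using notin yS by blast
      ultimately have "y \<in> interior T" by (blast intro: interiorI)
      then show False unfolding interior_simplex2_eq_bary[OF sT] using V(1) y(3) by simp
    qed
    then show ?thesis using yT T S by blast
  qed
  moreover have "bary T p y > 0 \<and> bary T q y > 0 \<and> bary T r y = 0" if "y \<in> open_segment p q" for y
  proof -
    have "\<exists>u>0. u < 1 \<and> y = (1 - u) *\<^sub>R p + u *\<^sub>R q"
      using that unfolding in_segment by (rule conjunct2)
    then obtain u where u: "0 < u" "u < 1" "y = (1 - u) *\<^sub>R p + u *\<^sub>R q"
      by (elim exE conjE)
    have "bary T v y = (1 - u) * bary T v p + u * bary T v q" for v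
      using bary_affine[of "{True,False}" "\<lambda>i. if i then 1 - u else u" T v "\<lambda>i. if i then p else q"] u(3)
      by simp
    then show ?thesis using u V by (simp add: bary_vertex[OF sT])
  qed
  ultimately have "open_segment p q \<subseteq> S - interior S" by blast
  then have "closure (open_segment p q) \<subseteq> closure (S - interior S)" by (rule closure_mono)
  then show "p \<in> closure (S - interior S)" "q \<in> closure (S - interior S)"
    using V(2) by (auto simp: closure_open_segment)
qed

text \<open>Such a point z has a zero coordinate, so it is a vertex or lies on an open side, where
  \<open>frontier_edge\<close> applies. Hence data that vanish at the boundary vertices have an
  interpolant that vanishes at z.\<close>

lemma frontier_bary_vertex:
  assumes tri: "triangulation_of \<T> S" and T: "T \<in> \<T>" and z: "z \<in> T" "z \<notin> interior S"
    and p: "p \<in> tri_vertices T" "bary T p z \<noteq> 0"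
  shows "p \<in> closure (S - interior S)"
proof -
  note sT = triangulation_simplex[OF tri T(1)]
  have TS: "T \<subseteq> S" using tri T by (auto simp: triangulation_of_def)
  then have "z \<notin> interior T" using z interior_mono by blast
  then obtain r where r: "r \<in> tri_vertices T" "bary T r z = 0"
    unfolding interior_simplex2_eq_bary[OF sT] using z(1) simplex2_eq_bary[OF sT] by force
  have "p \<noteq> r" using r p by auto
  obtain a b where ab: "tri_vertices T = {r,a,b}" "r \<noteq> a" "r \<noteq> b" "a \<noteq> b"
    using simplex2_obtain[OF sT r(1)] .
  then obtain q where V: "tri_vertices T = {p,q,r}" "p \<noteq> q" "p \<noteq> r" "q \<noteq> r"
    using p(1) \<open>p \<noteq> r\<close> by auto
  have pos: "bary T p z > 0" "bary T q z \<ge> 0"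
    using z(1) p(2) V(1) simplex2_eq_bary[OF sT] by force+
  show ?thesis
  proof (cases "bary T q z = 0")
    case True
    have "z = p" using bary_combination[OF sT, of z] V r(2) True by simp
    then show ?thesis using z TS closure_subset by blast
  next
    case False
    then show ?thesis using frontier_edge(1)[OF tri T V pos(1) _ r(2) z(2)] pos by simp
  qed
qed

section \<open>Simple polygons and Lipschitz perturbations\<close>


lemma polygonal_path_ends:
  "ps \<noteq> [] \<Longrightarrow> pathstart (polygonal_path ps) = hd ps \<and> pathfinish (polygonal_path ps) = last ps"
  by (induction ps rule: polygonal_path.induct) auto

text \<open>Components of the complements correspond under f, and boundedness is preserved in both
  directions. This carries the Jordan curve theorem from curves in the complex numbers to
  \<open>real^2\<close>.\<close>

lemma inside_linear_image:
  fixes f :: "'a::euclidean_space \<Rightarrow> 'b::euclidean_space"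
  assumes f: "linear f" and g: "linear g" and fg: "\<And>z. f (g z) = z" and gf: "\<And>z. g (f z) = z"
  shows "inside (f ` S) = f ` inside S"
proof -
  have inj: "inj f" using gf by (metis injI)
  have compl: "- (f ` S) = f ` (- S)"
    using bij_image_Compl_eq[of f S] inj fg by (metis bij_def surjI)
  have hom: "homeomorphism (- S) (f ` (- S)) f g"
    using gf by (intro homeomorphismI) (auto simp: f g linear_continuous_on linear_conv_bounded_linear[symmetric])
  have bdd: "bounded (f ` X) \<longleftrightarrow> bounded X" for X
  proof
    assume "bounded (f ` X)"
    then have "bounded (g ` f ` X)" using g bounded_linear_image linear_conv_bounded_linear by blast
    then show "bounded X" by (simp add: image_image gf)
  qed (use f bounded_linear_image linear_conv_bounded_linear in blast)
  have "f x \<in> inside (f ` S) \<longleftrightarrow> x \<in> inside S" for x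
  proof (cases "x \<in> S")
    case False
    then have "connected_component_set (- (f ` S)) (f x) = f ` connected_component_set (- S) x"
      unfolding compl using connected_component_set_homeomorphism[OF hom] by simp
    then show ?thesis using False inj by (simp add: inside_def bdd inj_image_mem_iff)
  qed (simp add: inside_def)
  then show ?thesis using fg by (auto simp: image_iff) metis
qed

text \<open>Apart from openness, the facts are transported from the Jordan curve theorem for
  \<open>f \<circ> c\<close>. The last conclusion makes the points of the closure that are not
  interior to it exactly the frontier of \<Omega>.\<close>

lemma simple_polygon_interior_props:
  assumes "simple_polygon_interior \<Omega>"
  shows "open \<Omega>" "connected \<Omega>" "bounded \<Omega>" "\<Omega> \<noteq> {}" "interior (closure \<Omega>) = \<Omega>"
proof -
  obtain ps where ps: "ps \<noteq> []" and sp: "simple_path (polygonal_path (ps @ [hd ps]))"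
    and \<Omega>: "\<Omega> = inside (path_image (polygonal_path (ps @ [hd ps])))"
    using assms unfolding simple_polygon_interior_def by blast
  define c where "c = polygonal_path (ps @ [hd ps])"
  have closed: "pathfinish c = pathstart c"
    using polygonal_path_ends[of "ps @ [hd ps]"] ps unfolding c_def by simp
  define f :: "plane \<Rightarrow> complex" where "f v = Complex (v$1) (v$2)" for v
  define g :: "complex \<Rightarrow> plane" where "g z = vector [Re z, Im z]" for z
  have fg: "f (g z) = z" for z by (simp add: f_def g_def)
  have gf: "g (f v) = v" for v by (simp add: f_def g_def Finite_Cartesian_Product.vec_eq_iff forall_2)
  have f: "linear f" by (rule linearI) (simp_all add: f_def complex_eq_iff)
  have g: "linear g" by (rule linearI) (simp_all add: g_def Finite_Cartesian_Product.vec_eq_iff forall_2)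
  have contf: "continuous_on S f" and contg: "continuous_on R g" for S R
    using f g linear_continuous_on linear_conv_bounded_linear by blast+
  have "simple_path (f \<circ> c)"
    using sp simple_path_linear_image_eq[OF f] gf unfolding c_def by (metis injI)
  moreover have "pathfinish (f \<circ> c) = pathstart (f \<circ> c)"
    using closed by (simp add: pathfinish_def pathstart_def)
  ultimately have J: "inside (path_image (f \<circ> c)) \<noteq> {}"
    "connected (inside (path_image (f \<circ> c)))" "bounded (inside (path_image (f \<circ> c)))"
    "inside (path_image (f \<circ> c)) \<inter> outside (path_image (f \<circ> c)) = {}"
    "inside (path_image (f \<circ> c)) \<union> outside (path_image (f \<circ> c)) = - path_image (f \<circ> c)"
    "frontier (inside (path_image (f \<circ> c))) = path_image (f \<circ> c)"
    "frontier (outside (path_image (f \<circ> c))) = path_image (f \<circ> c)"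
    using Jordan_inside_outside[of "f \<circ> c"] by blast+
  define I where "I = inside (path_image (f \<circ> c))"
  define X where "X = outside (path_image (f \<circ> c))"
  have If: "I = f ` \<Omega>"
    unfolding I_def \<Omega> c_def[symmetric] path_image_compose using inside_linear_image[OF f g fg gf] .
  have Ig: "\<Omega> = g ` I" unfolding If by (simp add: image_image gf)
  note J = J[folded I_def X_def]
  show "open \<Omega>" unfolding \<Omega> using sp by (intro open_inside closed_simple_path_image)
  show "connected \<Omega>" unfolding Ig using connected_continuous_image[OF contg J(2)] .
  show "bounded \<Omega>"
    unfolding Ig using J(3) g bounded_linear_image linear_conv_bounded_linear by blast
  show "\<Omega> \<noteq> {}" unfolding Ig using J(1) by simp
  show "interior (closure \<Omega>) = \<Omega>"
  proof
    show "\<Omega> \<subseteq> interior (closure \<Omega>)"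
      by (rule interior_maximal[OF closure_subset \<open>open \<Omega>\<close>])
    show "interior (closure \<Omega>) \<subseteq> \<Omega>"
    proof (intro subsetI, rule ccontr)
      fix x assume x: "x \<in> interior (closure \<Omega>)" "x \<notin> \<Omega>"
      have "f ` closure \<Omega> \<subseteq> closure I"
        by (rule image_closure_subset[OF contf closed_closure]) (simp add: If closure_subset)
      then have clf: "f y \<in> closure I" if "y \<in> closure \<Omega>" for y
        using that by (simp add: image_subset_iff)
      have "f x \<in> closure I" using x interior_subset clf by blast
      moreover have "f x \<notin> I" using x gf unfolding If by (metis imageE)
      \<comment> \<open>The curve is the frontier of the outside too, so every neighbourhood of a
        point on it meets the outside; this rules out slits.\<close>
      ultimately have "f x \<in> frontier X" using J(6,7) closure_Un_frontier by blast
      then have "f x \<in> closure X" by (simp add: frontier_def)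
      moreover have "f x \<in> g -` interior (closure \<Omega>)" using x gf by simp
      ultimately have "g -` interior (closure \<Omega>) \<inter> closure X \<noteq> {}" by auto
      moreover have "open (g -` interior (closure \<Omega>))"
        using contg by (intro open_vimage) auto
      ultimately have "g -` interior (closure \<Omega>) \<inter> X \<noteq> {}"
        using open_Int_closure_eq_empty[of "g -` interior (closure \<Omega>)" X] by simp
      then obtain y where y: "y \<in> X" "g y \<in> interior (closure \<Omega>)" by auto
      then have "g y \<in> closure \<Omega>" by (metis subsetD[OF interior_subset])
      then have "y \<in> closure I" using clf[of "g y"] fg by simp
      then have "y \<in> I \<or> y \<in> path_image (f \<circ> c)" using closure_Un_frontier[of I] J(6) by auto
      moreover have "y \<notin> path_image (f \<circ> c)" using J(5) y(1) by auto
      ultimately show False using y(1) J(4) by auto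
    qed
  qed
qed

text \<open>An extreme point of the convex hull of the closure is extreme in every triangle that
  contains it, hence a vertex, and it cannot lie in the open set \<Omega>. It guarantees that at
  least one Dirichlet value is prescribed.\<close>

lemma exists_boundary_vertex:
  assumes tri: "triangulation_of \<T> (closure \<Omega>)" and \<Omega>: "open \<Omega>" "bounded \<Omega>" "\<Omega> \<noteq> {}"
  shows "\<exists>p \<in> vertices \<T>. p \<in> frontier \<Omega>"
proof -
  let ?K = "convex hull (closure \<Omega>)"
  have "compact ?K" using \<Omega> by (simp add: compact_convex_hull)
  then obtain p where p: "p extreme_point_of ?K"
    using extreme_point_exists_convex[of ?K] \<Omega>(3) by auto
  then have pc: "p \<in> closure \<Omega>" by (rule extreme_point_of_convex_hull)
  then obtain T where T: "T \<in> \<T>" "p \<in> T" using triangulation_Union[OF tri] by blast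
  have "T \<subseteq> ?K" using triangulation_Union[OF tri] T hull_subset[of "closure \<Omega>" convex] by blast
  then have "p extreme_point_of T" using p T(2) by (auto simp: extreme_point_of_def)
  then have "p \<in> vertices \<T>" using T by (auto simp: vertices_def tri_vertices_def)
  moreover have "p \<notin> \<Omega>"
  proof
    assume "p \<in> \<Omega>"
    then have "p \<in> interior ?K"
      using \<Omega>(1) closure_subset hull_subset[of "closure \<Omega>" convex] by (meson interiorI order_trans)
    then show False using extreme_point_not_in_interior[OF p] by simp
  qed
  ultimately show ?thesis using pc \<Omega>(1) by (auto simp: frontier_def interior_open)
qed

section \<open>Lipschitz displacements and perturbations of the identity\<close>

lemma lipschitz_interp: "\<exists>C. C-lipschitz_on S (interp T g)"
proof -
  define C where "C = (\<Sum>p\<in>tri_vertices T. norm (bary_grad T p) * norm (g p))"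
  have "C-lipschitz_on S (interp T g)"
  proof (rule lipschitz_onI)
    fix y z
    have "norm (interp T g y - interp T g z) \<le> (\<Sum>p\<in>tri_vertices T. norm ((bary_grad T p \<bullet> (y - z)) *\<^sub>R g p))"
      unfolding interp_diff by (rule norm_sum)
    also have "\<dots> \<le> (\<Sum>p\<in>tri_vertices T. (norm (bary_grad T p) * norm (g p)) * norm (y - z))"
    proof (intro sum_mono)
      fix p
      have "\<bar>bary_grad T p \<bullet> (y - z)\<bar> * norm (g p) \<le> (norm (bary_grad T p) * norm (y - z)) * norm (g p)"
        by (intro mult_right_mono Cauchy_Schwarz_ineq2) simp
      then show "norm ((bary_grad T p \<bullet> (y - z)) *\<^sub>R g p) \<le> (norm (bary_grad T p) * norm (g p)) * norm (y - z)"
        by (simp add: mult_ac)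
    qed
    finally show "dist (interp T g y) (interp T g z) \<le> C * dist y z"
      by (simp add: C_def dist_norm sum_distrib_right)
  qed (simp add: C_def sum_nonneg)
  then show ?thesis by (rule exI)
qed

text \<open>The segment from x to y may leave and re-enter the pieces. Along it their preimages are
  finitely many closed sets covering [0,1], and on an interval a common Lipschitz constant extends
  across such a cover.\<close>

lemma lipschitz_closed_cover:
  fixes W :: "'a::real_normed_vector \<Rightarrow> 'b::real_normed_vector"
  assumes fin: "finite \<U>" and cov: "\<Union>\<U> = UNIV" and cl: "\<And>U. U \<in> \<U> \<Longrightarrow> closed U"
    and lip: "\<And>U. U \<in> \<U> \<Longrightarrow> \<exists>C. C-lipschitz_on U W"
  shows "\<exists>C. C-lipschitz_on UNIV W"
proof -
  obtain c where c: "\<And>U. U \<in> \<U> \<Longrightarrow> (c U)-lipschitz_on U W" using lip by metis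
  define C where "C = (\<Sum>U\<in>\<U>. c U)"
  have nn: "0 \<le> c U" if "U \<in> \<U>" for U using c[OF that] lipschitz_on_nonneg by blast
  have C: "C-lipschitz_on U W" if "U \<in> \<U>" for U
    using c[OF that] nn fin that unfolding C_def
    by (intro lipschitz_on_le[OF c[OF that]] member_le_sum) auto
  have C0: "0 \<le> C" unfolding C_def using nn by (intro sum_nonneg)
  have "C-lipschitz_on UNIV W"
  proof (rule lipschitz_onI[OF _ C0])
    fix x y :: 'a
    define \<gamma> where "\<gamma> s = x + s *\<^sub>R (y - x)" for s :: real
    have "(C * norm (y - x))-lipschitz_on {0..1} (W \<circ> \<gamma>)"
    proof (rule lipschitz_on_closed_Union[where U="\<lambda>U. \<gamma> -` U" and I=\<U>])
      fix U assume U: "U \<in> \<U>"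
      have "(norm (y - x))-lipschitz_on (\<gamma> -` U) \<gamma>"
        by (rule lipschitz_onI) (auto simp: \<gamma>_def dist_norm simp flip: scaleR_diff_left)
      moreover have "C-lipschitz_on (\<gamma> ` (\<gamma> -` U)) W"
        using C[OF U] by (rule lipschitz_on_subset) auto
      ultimately show "(C * norm (y - x))-lipschitz_on (\<gamma> -` U) (W \<circ> \<gamma>)"
        by (rule lipschitz_on_compose)
      show "closed (\<gamma> -` U)"
        unfolding \<gamma>_def using cl[OF U] by (intro closed_vimage continuous_intros)
    qed (use fin C0 cov in auto)
    from lipschitz_onD[OF this, of 0 1] show "dist (W x) (W y) \<le> C * dist x y"
      by (simp add: \<gamma>_def dist_norm norm_minus_commute)
  qed
  then show ?thesis by (rule exI)
qed

text \<open>A preimage of y is a fixed point of the map sending z to y - t W z, which is a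
  contraction.\<close>

lemma bij_lipschitz_perturbation:
  fixes W :: "'a::banach \<Rightarrow> 'a"
  assumes W: "C-lipschitz_on UNIV W" and t: "\<bar>t\<bar> * C < 1"
  shows "bij (\<lambda>z. z + t *\<^sub>R W z)"
proof -
  have nn: "0 \<le> \<bar>t\<bar> * C" using lipschitz_on_nonneg[OF W] by simp
  have ex1: "\<exists>!z. y - t *\<^sub>R W z = z" for y
  proof (rule banach_fix_type[OF nn t], intro allI)
    fix a b
    have "dist (y - t *\<^sub>R W a) (y - t *\<^sub>R W b) = \<bar>t\<bar> * dist (W a) (W b)"
      by (simp add: dist_norm norm_minus_commute flip: scaleR_diff_right)
    also have "\<dots> \<le> \<bar>t\<bar> * (C * dist a b)"
      using lipschitz_onD[OF W, of a b] by (intro mult_left_mono) auto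
    finally show "dist (y - t *\<^sub>R W a) (y - t *\<^sub>R W b) \<le> \<bar>t\<bar> * C * dist a b" by (simp add: mult_ac)
  qed
  have "y - t *\<^sub>R W z = z \<longleftrightarrow> z + t *\<^sub>R W z = y" for y z by (auto simp: algebra_simps)
  then have "\<exists>!z. z + t *\<^sub>R W z = y" for y using ex1[of y] by simp
  then show ?thesis unfolding bij_iff by blast
qed

section \<open>Deformation of a triangulation\<close>


text \<open>A point of a triangle outside \<Omega> has nonzero barycentric coordinates only at
  boundary vertices, where w vanishes.\<close>

lemma pl_extension_frontier:
  assumes \<Omega>: "open \<Omega>" "interior (closure \<Omega>) = \<Omega>" and tri: "triangulation_of \<T> (closure \<Omega>)"
    and w: "\<forall>p \<in> vertices \<T> \<inter> frontier \<Omega>. w p = 0"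
    and T: "T \<in> \<T>" "z \<in> T" "z \<notin> \<Omega>"
  shows "interp T w z = 0"
proof -
  have fr: "closure (closure \<Omega> - interior (closure \<Omega>)) = frontier \<Omega>"
    using \<Omega> by (metis closure_closed frontier_closed frontier_def interior_open)
  have "bary T p z *\<^sub>R w p = 0" if p: "p \<in> tri_vertices T" for p
  proof (cases "bary T p z = 0")
    case False
    have "p \<in> closure (closure \<Omega> - interior (closure \<Omega>))"
      by (rule frontier_bary_vertex[OF tri T(1,2) _ p False]) (simp add: \<Omega>(2) T(3))
    then have "p \<in> frontier \<Omega>" unfolding fr .
    moreover have "p \<in> vertices \<T>" using T(1) p unfolding vertices_def by (rule UN_I)
    ultimately show ?thesis using w by simp
  qed simp
  then show ?thesis unfolding interp_def by (intro sum.neutral) simp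
qed

text \<open>The closed cover consists of the triangles and the complement of \<Omega>; where these
  meet, both descriptions of W give 0.\<close>

lemma zero_extension_lipschitz:
  assumes \<Omega>: "open \<Omega>" "interior (closure \<Omega>) = \<Omega>" and tri: "triangulation_of \<T> (closure \<Omega>)"
    and w: "\<forall>p \<in> vertices \<T> \<inter> frontier \<Omega>. w p = 0"
  defines "W \<equiv> \<lambda>z. if z \<in> \<Omega> then pl_extension \<T> w z else 0"
  shows "\<exists>C. C-lipschitz_on UNIV W"
    and "T \<in> \<T> \<Longrightarrow> z \<in> T \<Longrightarrow> W z = interp T w z"
proof -
  have W: "W z = interp T w z" if "T \<in> \<T>" "z \<in> T" for T z
    using pl_extension_frontier[OF \<Omega> tri w that] pl_extension(3)[OF tri that, of w] by (auto simp: W_def)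
  show "T \<in> \<T> \<Longrightarrow> z \<in> T \<Longrightarrow> W z = interp T w z" by (rule W)
  have "\<exists>C. C-lipschitz_on U W" if "U \<in> insert (- \<Omega>) \<T>" for U
  proof (cases "U \<in> \<T>")
    case True
    obtain C where "C-lipschitz_on U (interp U w)" using lipschitz_interp by metis
    then have "C-lipschitz_on U W" by (rule lipschitz_on_transform) (simp add: W[OF True])
    then show ?thesis by (rule exI)
  next
    case False
    then have "0-lipschitz_on U W" using that by (intro lipschitz_onI) (auto simp: W_def)
    then show ?thesis by (rule exI)
  qed
  then show "\<exists>C. C-lipschitz_on UNIV W"
  proof (intro lipschitz_closed_cover[of "insert (- \<Omega>) \<T>"])
    show "finite (insert (- \<Omega>) \<T>)" using triangulation_finite[OF tri] by simp
    show "\<Union>(insert (- \<Omega>) \<T>) = UNIV" using triangulation_Union[OF tri] closure_subset[of \<Omega>] by auto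
    show "closed U" if "U \<in> insert (- \<Omega>) \<T>" for U
      using that \<Omega>(1) simplex2_props(3) triangulation_simplex[OF tri] by auto
  qed
qed

section \<open>Linear parts, affine images of triangles and of triangulations\<close>

definition lin :: "plane set \<Rightarrow> (plane \<Rightarrow> plane) \<Rightarrow> plane \<Rightarrow> plane" where
  "lin T g y = (\<Sum>p\<in>tri_vertices T. (bary_grad T p \<bullet> y) *\<^sub>R g p)"

lemma linear_lin: "linear (lin T g)"
  unfolding lin_def by (rule linear_interp)

lemma interp_lin: "interp T g z = lin T g z + interp T g 0"
  unfolding lin_def by (rule interp_eq_linear)

lemma lin_perturb:
  assumes "2 simplex T"
  shows "lin T (\<lambda>p. p + t *\<^sub>R w p) y = y + t *\<^sub>R lin T w y"
proof -
  have "lin T (\<lambda>p. p + t *\<^sub>R w p) y = (\<Sum>p\<in>tri_vertices T. (bary_grad T p \<bullet> y) *\<^sub>R p) + t *\<^sub>R lin T w y"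
    unfolding lin_def by (simp add: scaleR_add_right sum.distrib scaleR_sum_right mult.commute)
  then show ?thesis using bary_grad_span[OF assms] by simp
qed

lemma interp_perturb:
  assumes "2 simplex T"
  shows "interp T (\<lambda>p. p + t *\<^sub>R w p) z = z + t *\<^sub>R interp T w z"
proof -
  have "interp T (\<lambda>p. p + t *\<^sub>R w p) z = (\<Sum>p\<in>tri_vertices T. bary T p z *\<^sub>R p) + t *\<^sub>R interp T w z"
    unfolding interp_def by (simp add: scaleR_add_right sum.distrib scaleR_sum_right mult.commute)
  then show ?thesis using bary_combination(2)[OF assms] by simp
qed

text \<open>The linear part is the identity plus t times that of w, so the determinant is a
  polynomial in t with value 1 at t = 0.\<close>

lemma det_perturb_pos:
  assumes "2 simplex T"
  shows "\<forall>\<^sub>F t in nhds 0. Determinants.det (matrix (lin T (\<lambda>p. p + t *\<^sub>R w p))) > 0"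
proof -
  have "Determinants.det (matrix (lin T (\<lambda>p. p + t *\<^sub>R w p))) =
    (1 + t * lin T w (axis 1 1) $ 1) * (1 + t * lin T w (axis 2 1) $ 2)
     - (t * lin T w (axis 2 1) $ 1) * (t * lin T w (axis 1 1) $ 2)" for t
    unfolding det_2 matrix_def lin_perturb[OF assms] by (simp add: axis_def)
  moreover have "((\<lambda>t. (1 + t * lin T w (axis 1 1) $ 1) * (1 + t * lin T w (axis 2 1) $ 2)
     - (t * lin T w (axis 2 1) $ 1) * (t * lin T w (axis 1 1) $ 2)) \<longlongrightarrow> 
     (1 + 0 * lin T w (axis 1 1) $ 1) * (1 + 0 * lin T w (axis 2 1) $ 2)
     - (0 * lin T w (axis 2 1) $ 1) * (0 * lin T w (axis 1 1) $ 2)) (nhds 0)"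
    by (intro tendsto_intros filterlim_ident)
  ultimately have "((\<lambda>t. Determinants.det (matrix (lin T (\<lambda>p. p + t *\<^sub>R w p)))) \<longlongrightarrow> 1) (nhds 0)"
    by simp
  from order_tendstoD(1)[OF this, of 0] show ?thesis by simp
qed

text \<open>\<open>\<Phi>\<close> is affine on T only, so each claim is reduced to subsets of T, on
  which it is A followed by a translation.\<close>

lemma simplex2_affine_image:
  fixes A :: "plane \<Rightarrow> plane"
  assumes T: "2 simplex T" and A: "linear A" "inj A" and \<Phi>: "\<And>z. z \<in> T \<Longrightarrow> \<Phi> z = A z + c"
  shows "2 simplex (\<Phi> ` T)" "tri_vertices (\<Phi> ` T) = \<Phi> ` tri_vertices T"
    "interior (\<Phi> ` T) = \<Phi> ` interior T"
    "measure lebesgue (interior (\<Phi> ` T)) = \<bar>Determinants.det (matrix A)\<bar> * measure lebesgue (interior T)"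
    "e \<subseteq> T \<Longrightarrow> \<Phi> ` (convex hull e) = convex hull (\<Phi> ` e)"
proof -
  have im: "\<Phi> ` X = (\<lambda>z. c + z) ` (A ` X)" if "X \<subseteq> T" for X
    unfolding image_image by (intro image_cong) (use that \<Phi> in auto)
  obtain C where C: "\<not> affine_dependent C" "int (card C) = 3" "T = convex hull C"
    using T by (auto simp: simplex_def)
  have VC: "tri_vertices T = C"
    using C by (auto simp: tri_vertices_def extreme_point_of_convex_hull_affine_independent)
  have hull: "\<Phi> ` (convex hull e) = convex hull (\<Phi> ` e)" if e: "e \<subseteq> T" for e
  proof -
    have "convex hull e \<subseteq> T" using e simplex2_props(2)[OF T] by (rule hull_minimal)
    then show ?thesis
      unfolding im[OF e] using im[of "convex hull e"]
      by (simp add: convex_hull_translation convex_hull_linear_image[OF A(1)])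
  qed
  show "e \<subseteq> T \<Longrightarrow> \<Phi> ` (convex hull e) = convex hull (\<Phi> ` e)" by (rule hull)
  have CT: "C \<subseteq> T" unfolding C(3) by (rule hull_subset)
  have "inj_on \<Phi> T" using A(2) \<Phi> by (auto simp: inj_on_def)
  then have card: "int (card (\<Phi> ` C)) = 3"
    using card_image[OF inj_on_subset[OF _ CT]] C(2) by metis
  have "aff_dim (\<Phi> ` C) = aff_dim C"
    unfolding im[OF CT] aff_dim_translation_eq by (rule aff_dim_injective_linear_image[OF A])
  then have ind: "\<not> affine_dependent (\<Phi> ` C)"
    using C(1,2) card by (simp add: affine_independent_iff_card)
  have "\<Phi> ` T = convex hull (\<Phi> ` C)" using hull[OF CT] C(3) by simp
  then show s: "2 simplex (\<Phi> ` T)" unfolding simplex_def using ind card by auto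
  show "tri_vertices (\<Phi> ` T) = \<Phi> ` tri_vertices T"
    unfolding VC using \<open>\<Phi> ` T = _\<close> ind
    by (auto simp: tri_vertices_def extreme_point_of_convex_hull_affine_independent)
  show int: "interior (\<Phi> ` T) = \<Phi> ` interior T"
    unfolding im[OF subset_refl] im[OF interior_subset]
    by (simp add: interior_translation interior_injective_linear_image[OF A])
  have "interior T \<in> lmeasurable"
    using simplex2_props(1)[OF T] compact_imp_bounded lmeasurable_interior by metis
  then show "measure lebesgue (interior (\<Phi> ` T)) = \<bar>Determinants.det (matrix A)\<bar> * measure lebesgue (interior T)"
    unfolding int im[OF interior_subset] by (simp add: measure_translation measure_linear_image[OF A(1)])
qed

text \<open>Injectivity on all of S turns the intersection of two image triangles into the image of
  the intersection; on that piece the map is affine and respects vertices and hulls.\<close>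

lemma triangulation_image:
  assumes tri: "triangulation_of \<T> S" and inj: "inj_on \<Phi> S"
    and A: "\<And>T. T \<in> \<T> \<Longrightarrow> linear (A T)" "\<And>T. T \<in> \<T> \<Longrightarrow> inj (A T)"
    and \<Phi>: "\<And>T z. T \<in> \<T> \<Longrightarrow> z \<in> T \<Longrightarrow> \<Phi> z = A T z + c T"
  shows "triangulation_of ((`) \<Phi> ` \<T>) (\<Phi> ` S)"
  unfolding triangulation_of_def
proof (intro conjI ballI impI)
  note img = simplex2_affine_image[OF triangulation_simplex[OF tri] A \<Phi>]
  have sub: "T \<subseteq> S" if "T \<in> \<T>" for T using that triangulation_Union[OF tri] by auto
  show "finite ((`) \<Phi> ` \<T>)" using triangulation_finite[OF tri] by simp
  show "2 simplex T'" if "T' \<in> (`) \<Phi> ` \<T>" for T' using that img(1) by auto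
  show "\<Union>((`) \<Phi> ` \<T>) = \<Phi> ` S" unfolding triangulation_Union[OF tri, symmetric] by auto
  fix X Y assume XY: "X \<in> (`) \<Phi> ` \<T>" "Y \<in> (`) \<Phi> ` \<T>" "X \<noteq> Y"
  then obtain T T' where T: "T \<in> \<T>" "T' \<in> \<T>" "X = \<Phi> ` T" "Y = \<Phi> ` T'" "T \<noteq> T'" by auto
  have int: "X \<inter> Y = \<Phi> ` (T \<inter> T')"
    unfolding T(3,4) using inj_on_image_Int[OF inj sub[OF T(1)] sub[OF T(2)]] by simp
  have side: "\<Phi> ` e \<in> tri_sides (\<Phi> ` U)" if U: "U \<in> \<T>" and e: "e \<in> tri_sides U" for e U
  proof -
    obtain p q where pq: "e = {p,q}" "p \<in> tri_vertices U" "q \<in> tri_vertices U" "p \<noteq> q"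
      using e by (auto simp: tri_sides_def)
    have "\<Phi> p \<noteq> \<Phi> q" using pq inj_onD[OF inj, of p q] sub[OF U] tri_vertices_subset[of U] by auto
    moreover have "tri_vertices (\<Phi> ` U) = \<Phi> ` tri_vertices U" by (rule img(2)) (use U in auto)
    ultimately show ?thesis
      unfolding tri_sides_def using pq by (intro CollectI exI[of _ "\<Phi> p"] exI[of _ "\<Phi> q"]) simp
  qed
  have "\<forall>T\<in>\<T>. \<forall>T'\<in>\<T>. T \<noteq> T' \<longrightarrow> T \<inter> T' = {} \<or>
        (\<exists>p \<in> tri_vertices T \<inter> tri_vertices T'. T \<inter> T' = {p}) \<or>
        (\<exists>e \<in> tri_sides T \<inter> tri_sides T'. T \<inter> T' = convex hull e)"
    using tri unfolding triangulation_of_def by (elim conjE)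
  note this[rule_format, OF T(1,2,5)]
  then consider "T \<inter> T' = {}" | p where "p \<in> tri_vertices T \<inter> tri_vertices T'" "T \<inter> T' = {p}"
    | e where "e \<in> tri_sides T \<inter> tri_sides T'" "T \<inter> T' = convex hull e"
    by blast
  then show "X \<inter> Y = {} \<or>
        (\<exists>p \<in> tri_vertices X \<inter> tri_vertices Y. X \<inter> Y = {p}) \<or>
        (\<exists>e \<in> tri_sides X \<inter> tri_sides Y. X \<inter> Y = convex hull e)"
  proof cases
    case 1
    then show ?thesis using int by simp
  next
    case (2 p)
    have "\<Phi> p \<in> tri_vertices X \<inter> tri_vertices Y"
      unfolding T(3,4) using img(2) T(1,2) 2(1) by auto
    moreover have "X \<inter> Y = {\<Phi> p}" unfolding int 2(2) by simp
    ultimately show ?thesis by (intro disjI2 disjI1 bexI)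
  next
    case (3 e)
    have "e \<subseteq> T" using 3(1) tri_side_subset[of e T] tri_vertices_subset[of T] by auto
    then have "X \<inter> Y = convex hull (\<Phi> ` e)" unfolding int 3(2) using img(5) T(1) by auto
    moreover have "\<Phi> ` e \<in> tri_sides X \<inter> tri_sides Y" unfolding T(3,4) using 3(1) side T(1,2) by auto
    ultimately show ?thesis by (intro disjI2 bexI)
  qed
qed

lemma has_derivative_affine_interior:
  fixes f :: "'a::euclidean_space \<Rightarrow> 'b::real_normed_vector"
  assumes "linear A" "\<And>z. z \<in> T \<Longrightarrow> f z = A z + c" "z \<in> interior T"
  shows "(f has_derivative A) (at z)"
proof -
  have "((\<lambda>z. A z + c) has_derivative A) (at z)"
    using has_derivative_add[OF linear_imp_has_derivative[OF assms(1)] has_derivative_const[of c]]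
    by simp
  then show ?thesis
    by (rule has_derivative_transform_within_open[of _ _ _ _ "interior T"])
      (use assms interior_subset[of T] in auto)
qed

lemma jacobian_affine_interior:
  fixes f :: "plane \<Rightarrow> plane"
  assumes "linear A" "\<And>z. z \<in> T \<Longrightarrow> f z = A z + c" "z \<in> interior T"
  shows "jacobian f (at z) = matrix A"
  unfolding jacobian_def
  using frechet_derivative_at[OF has_derivative_affine_interior[of A T f c z, OF assms]] by simp

section \<open>Triangle energies\<close>


lemma hat_eq_bary:
  assumes tri: "triangulation_of \<T> S" and T: "T \<in> \<T>" "z \<in> T"
  shows "hat \<T> x j z = bary T (x j) z"
proof -
  note sT = triangulation_simplex[OF tri T(1)]
  have "hat \<T> x j z = (\<Sum>p\<in>tri_vertices T. if p = x j then bary T (x j) z else 0)"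
    unfolding hat_def pl_extension(3)[OF tri T] interp_def by (intro sum.cong) auto
  also have "\<dots> = bary T (x j) z"
    using simplex2_vertices(4)[OF sT] by (auto simp: bary_def)
  finally show ?thesis .
qed

lemma grad_hat:
  assumes tri: "triangulation_of \<T> S" and T: "T \<in> \<T>" "z \<in> interior T"
  shows "grad (hat \<T> x j) z = bary_grad T (x j)"
proof -
  define c where "c = (if x j \<in> tri_vertices T then 1 - bary_grad T (x j) \<bullet> x j else 0)"
  have *: "hat \<T> x j y = y \<bullet> bary_grad T (x j) + c" if "y \<in> T" for y
    unfolding hat_eq_bary[OF tri T(1) that] c_def bary_def
    by (simp add: inner_diff inner_commute bary_grad_def)
  have "((\<lambda>y. y \<bullet> bary_grad T (x j) + c) has_derivative (\<lambda>h. h \<bullet> bary_grad T (x j))) (at z)"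
    by (auto intro!: derivative_eq_intros)
  then have der: "(hat \<T> x j has_derivative (\<lambda>h. h \<bullet> bary_grad T (x j))) (at z)"
    by (rule has_derivative_transform_within_open[of _ _ _ _ "interior T"])
      (use T * interior_subset[of T] in auto)
  show ?thesis
    unfolding grad_def
  proof (rule the_equality)
    show "GDERIV (hat \<T> x j) z :> bary_grad T (x j)" unfolding gderiv_def by (rule der)
    fix D assume "GDERIV (hat \<T> x j) z :> D"
    then have "(\<lambda>h. h \<bullet> D) = (\<lambda>h. h \<bullet> bary_grad T (x j))"
      using der has_derivative_unique unfolding gderiv_def by metis
    then have "\<And>h. h \<bullet> (D - bary_grad T (x j)) = 0" by (simp add: inner_diff_right fun_eq_iff)
    from this[of "D - bary_grad T (x j)"] show "D = bary_grad T (x j)" by simp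
  qed
qed

text \<open>The element stiffness coefficient: area times the constant integrand. Being indexed by
  points, it is independent of a labelling, and it is 0 unless both points are vertices of
  T.\<close>

definition tri_energy :: "plane set \<Rightarrow> real^2^2 \<Rightarrow> plane \<Rightarrow> plane \<Rightarrow> real" where
  "tri_energy T A p q = measure lebesgue (interior T) * ((A *v bary_grad T p) \<bullet> bary_grad T q)"

text \<open>As \<open>\<sigma>\<close> vanishes off the triangle interiors, the integrand is at
  every point a combination of their indicator functions, whatever \<open>grad\<close> is on the
  sides. The condition on D covers both a single triangle and a set containing the interior of
  S.\<close>

lemma energy_eq_sum:
  assumes tri: "triangulation_of \<T> S"
    and \<sigma>: "\<And>T p. T \<in> \<T> \<Longrightarrow> p \<in> interior T \<Longrightarrow> \<sigma> p = A T"
      "\<And>p. p \<notin> (\<Union>T\<in>\<T>. interior T) \<Longrightarrow> \<sigma> p = 0"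
    and D: "\<And>T. T \<in> \<T> \<Longrightarrow> interior T \<subseteq> D \<or> interior T \<inter> D = {}"
  shows "energy \<T> x \<sigma> D j k = (\<Sum>T | T \<in> \<T> \<and> interior T \<subseteq> D. tri_energy T (A T) (x j) (x k))"
proof -
  define \<D> where "\<D> = {T \<in> \<T>. interior T \<subseteq> D}"
  define c where "c T = (A T *v bary_grad T (x j)) \<bullet> bary_grad T (x k)" for T
  have fin: "finite \<D>" unfolding \<D>_def using triangulation_finite[OF tri] by simp
  have lm: "interior T \<in> lmeasurable" if "T \<in> \<D>" for T
    using that simplex2_props(1)[OF triangulation_simplex[OF tri]] compact_imp_bounded lmeasurable_interior
    unfolding \<D>_def by auto
  have "indicator D p *\<^sub>R ((\<sigma> p *v grad (hat \<T> x j) p) \<bullet> grad (hat \<T> x k) p)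
      = (\<Sum>T\<in>\<D>. indicator (interior T) p * c T)" for p
  proof (cases "p \<in> D \<and> p \<in> (\<Union>T\<in>\<T>. interior T)")
    case True
    then obtain T where T: "T \<in> \<T>" "p \<in> interior T" by auto
    have TD: "T \<in> \<D>" unfolding \<D>_def using T D[OF T(1)] True by auto
    have "(\<Sum>T'\<in>\<D>. indicator (interior T') p * c T') = (\<Sum>T'\<in>\<D>. if T' = T then c T else 0)"
    proof (intro sum.cong refl)
      fix T' assume T': "T' \<in> \<D>"
      show "indicator (interior T') p * c T' = (if T' = T then c T else 0)"
        using disjoint_interiors[OF tri T(1), of T'] T T' by (auto simp: \<D>_def indicator_def)
    qed
    also have "\<dots> = c T" using fin TD by simp
    finally show ?thesis using True by (simp add: \<sigma>(1)[OF T] grad_hat[OF tri T] c_def)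
  next
    case False
    have "(\<Sum>T\<in>\<D>. indicator (interior T) p * c T) = 0"
      using False by (intro sum.neutral) (auto simp: \<D>_def indicator_def)
    then show ?thesis using False \<sigma>(2) by (cases "p \<in> D") auto
  qed
  then have "energy \<T> x \<sigma> D j k = (LINT p|lebesgue. (\<Sum>T\<in>\<D>. indicator (interior T) p * c T))"
    unfolding energy_def set_lebesgue_integral_def by simp
  also have "\<dots> = (\<Sum>T\<in>\<D>. LINT p|lebesgue. indicator (interior T) p * c T)"
    using lm by (intro Bochner_Integration.integral_sum integrable_mult_left integrable_real_indicator)
      (auto simp: fmeasurable_def)
  also have "\<dots> = (\<Sum>T\<in>\<D>. measure lebesgue (interior T) * c T)"
    using lm by (intro sum.cong) auto
  finally show ?thesis unfolding \<D>_def c_def tri_energy_def .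
qed

lemma energy_triangle:
  assumes tri: "triangulation_of \<T> S"
    and \<sigma>: "\<And>T p. T \<in> \<T> \<Longrightarrow> p \<in> interior T \<Longrightarrow> \<sigma> p = A T"
      "\<And>p. p \<notin> (\<Union>T\<in>\<T>. interior T) \<Longrightarrow> \<sigma> p = 0"
    and T: "T \<in> \<T>"
  shows "energy \<T> x \<sigma> T j k = tri_energy T (A T) (x j) (x k)"
proof -
  have disj: "interior T' \<inter> T = {}" if "T' \<in> \<T>" "T' \<noteq> T" for T'
  proof -
    \<comment> \<open>An open set disjoint from the interior of T is disjoint from its closure,
      which is all of T.\<close>
    have "interior T' \<inter> closure (interior T) = {}"
      using disjoint_interiors[OF tri that(1) T that(2)]
      by (simp add: open_Int_closure_eq_empty)
    then show ?thesis using simplex2_props(4)[OF triangulation_simplex[OF tri T]] by simp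
  qed
  have "T' = T" if T': "T' \<in> \<T>" "interior T' \<subseteq> T" for T'
  proof (rule ccontr)
    assume "T' \<noteq> T"
    then have "interior T' = {}" using disj[OF T'(1)] T'(2) by auto
    then show False using simplex2_props(5)[OF triangulation_simplex[OF tri T'(1)]] by simp
  qed
  then have eq: "{T' \<in> \<T>. interior T' \<subseteq> T} = {T}"
    using T interior_subset[of T] by auto
  have "interior T' \<subseteq> T \<or> interior T' \<inter> T = {}" if "T' \<in> \<T>" for T'
    using disj[OF that] interior_subset[of T] by (cases "T' = T") simp_all
  from energy_eq_sum[where A=A and \<sigma>=\<sigma> and x=x and j=j and k=k and D=T, OF tri \<sigma> this]
  show ?thesis unfolding eq by simp
qed

lemma energy_domain:
  assumes tri: "triangulation_of \<T> S"
    and \<sigma>: "\<And>T p. T \<in> \<T> \<Longrightarrow> p \<in> interior T \<Longrightarrow> \<sigma> p = A T"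
      "\<And>p. p \<notin> (\<Union>T\<in>\<T>. interior T) \<Longrightarrow> \<sigma> p = 0"
    and D: "interior S \<subseteq> D"
  shows "energy \<T> x \<sigma> D j k = (\<Sum>T\<in>\<T>. tri_energy T (A T) (x j) (x k))"
proof -
  have sub: "interior T \<subseteq> D" if "T \<in> \<T>" for T
    using D triangulation_Union[OF tri] that interior_mono[of T S] by auto
  then have "{T \<in> \<T>. interior T \<subseteq> D} = \<T>" by auto
  then show ?thesis using energy_eq_sum[where A=A and \<sigma>=\<sigma> and x=x and j=j and k=k and D=D, OF tri \<sigma>] sub by simp
qed

section \<open>Symmetric matrices and the energies of the sides of a triangle\<close>

definition cell_matrix :: "(plane \<Rightarrow> real^2^2) \<Rightarrow> plane set \<Rightarrow> real^2^2" where
  "cell_matrix \<sigma> T = (SOME A. Finite_Cartesian_Product.transpose A = A \<and> (\<forall>p\<in>interior T. \<sigma> p = A))"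

lemma PC_cell:
  assumes \<sigma>: "\<sigma> \<in> PC \<T>"
  shows "\<And>T. T \<in> \<T> \<Longrightarrow> Finite_Cartesian_Product.transpose (cell_matrix \<sigma> T) = cell_matrix \<sigma> T"
    and "\<And>T p. T \<in> \<T> \<Longrightarrow> p \<in> interior T \<Longrightarrow> \<sigma> p = cell_matrix \<sigma> T"
    and "\<And>p. p \<notin> (\<Union>T\<in>\<T>. interior T) \<Longrightarrow> \<sigma> p = 0"
proof -
  have *: "Finite_Cartesian_Product.transpose (cell_matrix \<sigma> T) = cell_matrix \<sigma> T \<and>
      (\<forall>p\<in>interior T. \<sigma> p = cell_matrix \<sigma> T)" if "T \<in> \<T>" for T
    unfolding cell_matrix_def by (rule someI_ex) (use \<sigma> that in \<open>simp add: PC_def\<close>)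
  show "\<And>T. T \<in> \<T> \<Longrightarrow> Finite_Cartesian_Product.transpose (cell_matrix \<sigma> T) = cell_matrix \<sigma> T"
    using * by simp
  show "\<And>T p. T \<in> \<T> \<Longrightarrow> p \<in> interior T \<Longrightarrow> \<sigma> p = cell_matrix \<sigma> T" using * by simp
  show "\<And>p. p \<notin> (\<Union>T\<in>\<T>. interior T) \<Longrightarrow> \<sigma> p = 0" using \<sigma> by (simp add: PC_def)
qed

lemma symmetric_matrix_inner:
  fixes A :: "real^2^2"
  assumes "Finite_Cartesian_Product.transpose A = A"
  shows "(A *v u) \<bullet> v = (A *v v) \<bullet> u"
proof -
  have "A$2$1 = A$1$2" proof -
    have "Finite_Cartesian_Product.transpose A $ 2 $ 1 = A $ 2 $ 1" using assms by simp
    then show ?thesis by (simp add: Finite_Cartesian_Product.transpose_def)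
  qed
  then show ?thesis
    by (simp add: inner_vec_def matrix_vector_mult_def sum_2 algebra_simps)
qed

lemma tri_energy_sym:
  "Finite_Cartesian_Product.transpose A = A \<Longrightarrow> tri_energy T A p q = tri_energy T A q p"
  using symmetric_matrix_inner[of A "bary_grad T p" "bary_grad T q"] by (simp add: tri_energy_def)

lemma tri_energy_nonvertex:
  "p \<notin> tri_vertices T \<or> q \<notin> tri_vertices T \<Longrightarrow> tri_energy T A p q = 0"
  by (auto simp: tri_energy_def bary_grad_def)

lemma simplex2_area_pos:
  fixes T :: "plane set"
  assumes "2 simplex T"
  shows "0 < measure lebesgue (interior T)"
proof -
  have lm: "interior T \<in> lmeasurable"
    using simplex2_props(1)[OF assms] compact_imp_bounded lmeasurable_interior by auto
  have "\<not> negligible (interior T)"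
    using open_not_negligible simplex2_props(5)[OF assms] by auto
  then have "measure lebesgue (interior T) \<noteq> 0"
    using lm unfolding negligible_iff_measure by (elim contrapos_nn) (rule conjI)
  then show ?thesis unfolding zero_less_measure_iff .
qed

lemma inner_bary_grad_eq_0:
  assumes T: "2 simplex T" and "\<And>p. p \<in> tri_vertices T \<Longrightarrow> y \<bullet> bary_grad T p = 0"
  shows "y = 0"
proof -
  have "(\<Sum>p\<in>tri_vertices T. (bary_grad T p \<bullet> y) *\<^sub>R p) = 0"
    using assms(2) by (intro sum.neutral) (simp add: inner_commute)
  then show ?thesis unfolding bary_grad_span[OF T] .
qed

text \<open>A symmetric 2 x 2 matrix has three free entries, and a triangle has three sides. For the
  difference M the diagonal values follow from the off-diagonal ones because the gradients add up to
  0, and the gradients span the plane.\<close>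

lemma symmetric_matrix_eqI:
  fixes A A' :: "real^2^2"
  assumes T: "2 simplex T"
    and sym: "Finite_Cartesian_Product.transpose A = A" "Finite_Cartesian_Product.transpose A' = A'"
    and eq: "\<And>p q. p \<in> tri_vertices T \<Longrightarrow> q \<in> tri_vertices T \<Longrightarrow> p \<noteq> q \<Longrightarrow> tri_energy T A p q = tri_energy T A' p q"
  shows "A = A'"
proof -
  define M where "M = A - A'"
  let ?g = "bary_grad T"
  have symM: "(M *v u) \<bullet> v = (M *v v) \<bullet> u" for u v
    unfolding M_def using symmetric_matrix_inner[OF sym(1)] symmetric_matrix_inner[OF sym(2)]
    by (simp add: matrix_vector_mult_diff_rdistrib inner_diff_left)
  have off: "(M *v ?g p) \<bullet> ?g q = 0" if "p \<in> tri_vertices T" "q \<in> tri_vertices T" "p \<noteq> q" for p q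
    using eq[OF that] simplex2_area_pos[OF T]
    by (simp add: tri_energy_def M_def matrix_vector_mult_diff_rdistrib inner_diff_left)
  have all: "(M *v ?g p) \<bullet> ?g q = 0" if p: "p \<in> tri_vertices T" "q \<in> tri_vertices T" for p q
  proof (cases "p = q")
    case True
    have "0 = (M *v ?g p) \<bullet> (\<Sum>q\<in>tri_vertices T. ?g q)" using sum_bary_grad[OF T] by simp
    also have "\<dots> = (\<Sum>q\<in>tri_vertices T. if q = p then (M *v ?g p) \<bullet> ?g p else 0)"
      unfolding inner_sum_right using off[OF p(1)] by (intro sum.cong) auto
    also have "\<dots> = (M *v ?g p) \<bullet> ?g p" using p simplex2_vertices(4)[OF T] by simp
    finally show ?thesis using True by simp
  qed (use off that in simp)
  have Mg: "M *v ?g p = 0" if "p \<in> tri_vertices T" for p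
    using inner_bary_grad_eq_0[OF T] all[OF that] by simp
  have "M *v y = 0" for y
    using inner_bary_grad_eq_0[OF T, of "M *v y"] symM[of y] Mg by simp
  then have "A *v y = A' *v y" for y by (simp add: M_def matrix_vector_mult_diff_rdistrib)
  then show ?thesis by (simp add: matrix_eq)
qed

definition outer :: "plane \<Rightarrow> real^2^2" where
  "outer d = (\<chi> i j. d$i * d$j)"

lemma outer_inner: "(outer d *v u) \<bullet> v = (d \<bullet> u) * (d \<bullet> v)"
  by (simp add: outer_def inner_vec_def matrix_vector_mult_def sum_2 algebra_simps)

lemma adjust_energies:
  assumes T: "2 simplex T" and A: "Finite_Cartesian_Product.transpose A = A"
    and \<delta>: "\<And>p q. \<delta> p q = \<delta> q p"
  shows "\<exists>A'. Finite_Cartesian_Product.transpose A' = A' \<and>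
    (\<forall>p\<in>tri_vertices T. \<forall>q\<in>tri_vertices T. p \<noteq> q \<longrightarrow>
       tri_energy T A' p q = tri_energy T A p q + \<delta> p q)"
proof -
  define a where "a = measure lebesgue (interior T)"
  have a: "a > 0" unfolding a_def by (rule simplex2_area_pos[OF T])
  define M where "M = (\<Sum>p\<in>tri_vertices T. \<Sum>q\<in>tri_vertices T. \<delta> p q *\<^sub>R outer (p - q))"
  \<comment> \<open>The form of p - q takes the value -1 on the gradients at p and q, each side
    occurs as two ordered pairs, and the energy carries the factor a: hence the minus sign and 1 /
    (2a).\<close>
  define A' where "A' = A - (1 / (2 * a)) *\<^sub>R M"
  have "M $ i $ j = M $ j $ i" for i j
    by (simp add: M_def outer_def mult.commute)
  then have "Finite_Cartesian_Product.transpose M = M"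
    by (simp add: Finite_Cartesian_Product.transpose_def Finite_Cartesian_Product.vec_eq_iff)
  then have sym: "Finite_Cartesian_Product.transpose A' = A'"
    using A by (simp add: A'_def Finite_Cartesian_Product.transpose_def Finite_Cartesian_Product.vec_eq_iff)
  have M: "(M *v u) \<bullet> v = (\<Sum>p\<in>tri_vertices T. \<Sum>q\<in>tri_vertices T. \<delta> p q * (((p - q) \<bullet> u) * ((p - q) \<bullet> v)))" for u v
  proof -
    have lin: "linear (\<lambda>M::real^2^2. (M *v u) \<bullet> v)"
      by (rule linearI) (simp_all add: matrix_vector_mult_add_rdistrib inner_add_left scaleR_matrix_vector_assoc[symmetric])
    show ?thesis unfolding M_def linear_sum[OF lin] linear_scale[OF lin] outer_inner by simp
  qed
  have "tri_energy T A' p q = tri_energy T A p q + \<delta> p q"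
    if pq: "p \<in> tri_vertices T" "q \<in> tri_vertices T" "p \<noteq> q" for p q
  proof -
  have "{p,q} \<in> tri_sides T" unfolding tri_sides_def using pq by auto
  then obtain r where V: "tri_vertices T = {p,q,r}" "p \<noteq> q" "p \<noteq> r" "q \<noteq> r" "orient p q r \<noteq> 0"
    by (rule tri_side_obtain[OF T])
  \<comment> \<open>The change of the coordinate of v along the side from c to b, read off the
    vertex values; only the side {p, q} itself has a nonzero product at p and q.\<close>
  have g: "(b - c) \<bullet> bary_grad T v = (if v = b then 1 else 0) - (if v = c then 1 else 0)"
    if "v \<in> tri_vertices T" "b \<in> tri_vertices T" "c \<in> tri_vertices T" for v b c
    using bary_diff[OF that(1), of b c] that by (simp add: bary_vertex[OF T] inner_commute)
  have "(M *v bary_grad T p) \<bullet> bary_grad T q = (\<Sum>b\<in>tri_vertices T. \<Sum>c\<in>tri_vertices T. \<delta> b c *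
      (((if p = b then 1 else 0) - (if p = c then 1 else 0)) * ((if q = b then 1 else 0) - (if q = c then 1 else 0))))"
    unfolding M by (intro sum.cong refl) (simp add: g pq)
  also have "\<dots> = - 2 * \<delta> p q"
    unfolding V(1) using V(2-4) \<delta>[of p q] by simp
  finally have "a * ((A' *v bary_grad T p) \<bullet> bary_grad T q) = a * ((A *v bary_grad T p) \<bullet> bary_grad T q) + \<delta> p q"
    using a by (simp add: A'_def matrix_vector_mult_diff_rdistrib inner_diff_left scaleR_matrix_vector_assoc[symmetric] algebra_simps)
  then show ?thesis unfolding tri_energy_def a_def[symmetric] .
  qed
  with sym show ?thesis by (intro exI[of _ A']) simp
qed

section \<open>The shift of edge energies\<close>


lemma tri_sidesI: "p \<in> tri_vertices T \<Longrightarrow> q \<in> tri_vertices T \<Longrightarrow> p \<noteq> q \<Longrightarrow> {p, q} \<in> tri_sides T"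
  unfolding tri_sides_def by auto

lemma energy_sym:
  assumes tri: "triangulation_of \<T> S" and \<sigma>: "\<sigma> \<in> PC \<T>" and T: "T \<in> \<T>"
  shows "energy \<T> x \<sigma> T j k = energy \<T> x \<sigma> T k j"
proof -
  define A where "A = cell_matrix \<sigma>"
  note A = PC_cell[OF \<sigma>, folded A_def]
  have "energy \<T> x \<sigma> T j k = tri_energy T (A T) (x j) (x k)" for j k
    by (rule energy_triangle[OF tri A(2,3) T])
  then show ?thesis using tri_energy_sym[OF A(1)[OF T]] by simp
qed

definition S_spec ::
  "plane set set \<Rightarrow> nat \<Rightarrow> (nat \<Rightarrow> plane) \<Rightarrow> (plane set \<Rightarrow> real) \<Rightarrow>
   (plane \<Rightarrow> real^2^2) \<Rightarrow> (plane \<Rightarrow> real^2^2) \<Rightarrow> bool" where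
  "S_spec \<T> N x \<beta> \<sigma> \<tau> \<longleftrightarrow> \<tau> \<in> PC \<T> \<and>
        (\<forall>j k T T'. j < k \<and> k < N \<and> {x j, x k} \<in> interior_edges \<T> \<and> T \<in> \<T> \<and> T' \<in> \<T> \<and>
                    ccw_side T (x j) (x k) \<and> ccw_side T' (x k) (x j) \<longrightarrow>
            energy \<T> x \<tau> T j k = energy \<T> x \<sigma> T j k + \<beta> {x j, x k} \<and>
            energy \<T> x \<tau> T' j k = energy \<T> x \<sigma> T' j k - \<beta> {x j, x k}) \<and>
        (\<forall>j k T. j < N \<and> k < N \<and> {x j, x k} \<in> boundary_edges \<T> \<and> T \<in> \<T> \<and>
                 {x j, x k} \<in> tri_sides T \<longrightarrow>
            energy \<T> x \<tau> T j k = energy \<T> x \<sigma> T j k)"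

lemma S_transform_eq: "S_transform \<T> N x \<beta> \<sigma> = (THE \<tau>. S_spec \<T> N x \<beta> \<sigma> \<tau>)"
  unfolding S_transform_def S_spec_def ..

text \<open>For a side of T the shift changes sign when p and q are exchanged, so p has to be the
  end with the smaller label. It also changes sign from T to the neighbour across the side.\<close>

definition edge_shift ::
  "plane set set \<Rightarrow> (plane set \<Rightarrow> real) \<Rightarrow> plane set \<Rightarrow> plane \<Rightarrow> plane \<Rightarrow> real" where
  "edge_shift \<T> \<beta> T p q = (if {p, q} \<in> interior_edges \<T>
     then if ccw_side T p q then \<beta> {p, q} else - \<beta> {p, q} else 0)"

lemma boundary_not_interior: "e \<in> boundary_edges \<T> \<Longrightarrow> e \<notin> interior_edges \<T>"
  by (simp add: boundary_edges_def interior_edges_def)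

text \<open>Both clauses in the definition of $S_\beta$ in one: labels are ordered $j < k$, and the sign of
  the shift is read off the orientation of the side.\<close>

lemma S_spec_iff:
  assumes tri: "triangulation_of \<T> S" and \<sigma>: "\<sigma> \<in> PC \<T>"
  shows "S_spec \<T> N x \<beta> \<sigma> \<tau> \<longleftrightarrow> \<tau> \<in> PC \<T> \<and>
    (\<forall>j k T. j < k \<longrightarrow> k < N \<longrightarrow> T \<in> \<T> \<longrightarrow> {x j, x k} \<in> tri_sides T \<longrightarrow>
      energy \<T> x \<tau> T j k = energy \<T> x \<sigma> T j k + edge_shift \<T> \<beta> T (x j) (x k))"
    (is "_ \<longleftrightarrow> _ \<and> ?R")
proof (intro iffI conjI)
  assume s: "S_spec \<T> N x \<beta> \<sigma> \<tau>"
  then show "\<tau> \<in> PC \<T>" by (simp add: S_spec_def)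
  have int: "energy \<T> x \<tau> T j k = energy \<T> x \<sigma> T j k + \<beta> {x j, x k} \<and>
            energy \<T> x \<tau> T' j k = energy \<T> x \<sigma> T' j k - \<beta> {x j, x k}"
    if "j < k" "k < N" "{x j, x k} \<in> interior_edges \<T>" "T \<in> \<T>" "T' \<in> \<T>"
       "ccw_side T (x j) (x k)" "ccw_side T' (x k) (x j)" for j k T T'
    using s that unfolding S_spec_def by simp
  have bd: "energy \<T> x \<tau> T j k = energy \<T> x \<sigma> T j k"
    if "j < N" "k < N" "{x j, x k} \<in> boundary_edges \<T>" "T \<in> \<T>" "{x j, x k} \<in> tri_sides T" for j k T
    using s that unfolding S_spec_def by simp
  show ?R
  proof (intro allI impI)
    fix j k T assume jk: "j < k" "k < N" and T: "T \<in> \<T>" "{x j, x k} \<in> tri_sides T"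
    consider "{x j, x k} \<in> boundary_edges \<T>"
      | T' where "{x j, x k} \<in> interior_edges \<T>" "T' \<in> \<T>" "T' \<noteq> T" "{x j, x k} \<in> tri_sides T'"
          "ccw_side T (x j) (x k) \<longleftrightarrow> ccw_side T' (x k) (x j)"
      using triangles_at_edge[OF tri T] by auto
    then show "energy \<T> x \<tau> T j k = energy \<T> x \<sigma> T j k + edge_shift \<T> \<beta> T (x j) (x k)"
    proof cases
      case 1
      then show ?thesis using bd[of j k T] jk T boundary_not_interior by (simp add: edge_shift_def)
    next
      case 2
      show ?thesis
      proof (cases "ccw_side T (x j) (x k)")
        case True
        then show ?thesis using int[OF jk 2(1) T(1) 2(2)] 2 by (simp add: edge_shift_def)
      next
        \<comment> \<open>T now runs along the side in the opposite direction, so the neighbour T'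
          takes the role of the triangle with the plus sign.\<close>
        case False
        then have "ccw_side T' (x j) (x k)" "ccw_side T (x k) (x j)"
          using 2 ccw_side_cases[OF triangulation_simplex[OF tri 2(2)] 2(4)]
            ccw_side_cases[OF triangulation_simplex[OF tri T(1)] T(2)] by simp_all
        then show ?thesis using int[OF jk 2(1) 2(2) T(1)] 2(1) False by (simp add: edge_shift_def)
      qed
    qed
  qed
next
  assume "\<tau> \<in> PC \<T> \<and> ?R"
  then have \<tau>: "\<tau> \<in> PC \<T>" and R: "\<And>j k T. j < k \<Longrightarrow> k < N \<Longrightarrow> T \<in> \<T> \<Longrightarrow> {x j, x k} \<in> tri_sides T \<Longrightarrow>
      energy \<T> x \<tau> T j k = energy \<T> x \<sigma> T j k + edge_shift \<T> \<beta> T (x j) (x k)"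
    by simp_all
  show "S_spec \<T> N x \<beta> \<sigma> \<tau>"
    unfolding S_spec_def
  proof (intro conjI allI impI; (elim conjE)?)
    show "\<tau> \<in> PC \<T>" by (rule \<tau>)
  next
    fix j k T T' assume *: "j < k" "k < N" "{x j, x k} \<in> interior_edges \<T>" "T \<in> \<T>" "T' \<in> \<T>"
       "ccw_side T (x j) (x k)" "ccw_side T' (x k) (x j)"
    have s: "{x j, x k} \<in> tri_sides T" using *(6) by (simp add: ccw_side_def)
    show "energy \<T> x \<tau> T j k = energy \<T> x \<sigma> T j k + \<beta> {x j, x k}"
      using R[OF *(1,2,4) s] * by (simp add: edge_shift_def)
  next
    fix j k T T' assume *: "j < k" "k < N" "{x j, x k} \<in> interior_edges \<T>" "T \<in> \<T>" "T' \<in> \<T>"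
       "ccw_side T (x j) (x k)" "ccw_side T' (x k) (x j)"
    have s: "{x j, x k} \<in> tri_sides T'" using *(7) by (simp add: ccw_side_def insert_commute)
    have "\<not> ccw_side T' (x j) (x k)"
      using ccw_side_cases[OF triangulation_simplex[OF tri *(5)] s] *(7) by simp
    then show "energy \<T> x \<tau> T' j k = energy \<T> x \<sigma> T' j k - \<beta> {x j, x k}"
      using R[OF *(1,2,5) s] * by (simp add: edge_shift_def)
  next
    fix j k T assume *: "j < N" "k < N" "{x j, x k} \<in> boundary_edges \<T>" "T \<in> \<T>" "{x j, x k} \<in> tri_sides T"
    \<comment> \<open>The boundary clause does not order the labels; the case k < j is reduced to
      this one by the symmetry of the energies.\<close>
    have ord: "energy \<T> x \<tau> T a b = energy \<T> x \<sigma> T a b"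
      if "a < b" "b < N" "{x a, x b} = {x j, x k}" for a b
      using R[OF that(1,2) *(4)] * boundary_not_interior[OF *(3)] that(3)
      by (simp add: edge_shift_def)
    have "j \<noteq> k" using *(5) by (auto simp: tri_sides_def doubleton_eq_iff)
    then consider "j < k" | "k < j" by linarith
    then show "energy \<T> x \<tau> T j k = energy \<T> x \<sigma> T j k"
    proof cases
      case 1
      then show ?thesis using ord * by simp
    next
      case 2
      then show ?thesis
        using ord[of k j] * energy_sym[OF tri \<tau> *(4)] energy_sym[OF tri \<sigma> *(4)] by (simp add: insert_commute)
    qed
  qed
qed

lemma PC_eqI:
  assumes "\<And>T p. T \<in> \<T> \<Longrightarrow> p \<in> interior T \<Longrightarrow> \<sigma> p = \<tau> p" "\<sigma> \<in> PC \<T>" "\<tau> \<in> PC \<T>"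
  shows "\<sigma> = \<tau>"
proof
  fix p
  show "\<sigma> p = \<tau> p"
    using assms by (cases "p \<in> (\<Union>T\<in>\<T>. interior T)") (auto simp: PC_def)
qed

text \<open>Justifies the \<open>THE\<close>. Existence is \<open>adjust_energies\<close> on each
  triangle separately, which is consistent as interiors are disjoint; uniqueness is
  \<open>symmetric_matrix_eqI\<close> together with the value 0 prescribed off the
  interiors.\<close>

lemma S_transform_spec:
  assumes tri: "triangulation_of \<T> S" and \<sigma>: "\<sigma> \<in> PC \<T>" and x: "bij_betw x {..<N} (vertices \<T>)"
  shows "S_spec \<T> N x \<beta> \<sigma> (S_transform \<T> N x \<beta> \<sigma>)"
  unfolding S_transform_eq
proof (rule theI'[of "S_spec \<T> N x \<beta> \<sigma>"], rule ex_ex1I)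
  define A where "A = cell_matrix \<sigma>"
  note A = PC_cell[OF \<sigma>, folded A_def]
  define lab where "lab = inv_into {..<N} x"
  have lab: "lab (x j) = j" if "j < N" for j
    unfolding lab_def using that x by (simp add: bij_betw_def)
  \<comment> \<open>The energies are symmetric in p and q, while \<open>edge_shift\<close> is not;
    ordering the ends by their labels yields the symmetric function that
    \<open>adjust_energies\<close> asks for.\<close>
  define \<delta> where "\<delta> T p q = (if lab p < lab q then edge_shift \<T> \<beta> T p q else if lab q < lab p then edge_shift \<T> \<beta> T q p else 0)" for T p q
  have "\<forall>T\<in>\<T>. \<exists>A'. Finite_Cartesian_Product.transpose A' = A' \<and>
     (\<forall>p\<in>tri_vertices T. \<forall>q\<in>tri_vertices T. p \<noteq> q \<longrightarrow>
       tri_energy T A' p q = tri_energy T (A T) p q + \<delta> T p q)"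
  proof
    fix T assume T: "T \<in> \<T>"
    have "\<delta> T p q = \<delta> T q p" for p q by (auto simp: \<delta>_def)
    then show "\<exists>A'. Finite_Cartesian_Product.transpose A' = A' \<and>
     (\<forall>p\<in>tri_vertices T. \<forall>q\<in>tri_vertices T. p \<noteq> q \<longrightarrow>
       tri_energy T A' p q = tri_energy T (A T) p q + \<delta> T p q)"
      by (rule adjust_energies[OF triangulation_simplex[OF tri T] A(1)[OF T]])
  qed
  from bchoice[OF this] obtain A' where A': "\<forall>T\<in>\<T>. Finite_Cartesian_Product.transpose (A' T) = A' T \<and>
     (\<forall>p\<in>tri_vertices T. \<forall>q\<in>tri_vertices T. p \<noteq> q \<longrightarrow>
       tri_energy T (A' T) p q = tri_energy T (A T) p q + \<delta> T p q)" ..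
  define \<tau> where "\<tau> p = (if p \<in> (\<Union>T\<in>\<T>. interior T) then A' (THE T. T \<in> \<T> \<and> p \<in> interior T) else 0)" for p
  have \<tau>: "\<tau> p = A' T" if "T \<in> \<T>" "p \<in> interior T" for T p
  proof -
    have "(THE T. T \<in> \<T> \<and> p \<in> interior T) = T"
      using that disjoint_interiors[OF tri] by (intro the_equality) auto
    then show ?thesis using that by (auto simp: \<tau>_def)
  qed
  have \<tau>0: "\<tau> p = 0" if "p \<notin> (\<Union>T\<in>\<T>. interior T)" for p unfolding \<tau>_def using that by simp
  have "\<tau> \<in> PC \<T>"
    unfolding PC_def
  proof (intro CollectI conjI ballI allI impI)
    fix T assume T: "T \<in> \<T>"
    show "\<exists>A. Finite_Cartesian_Product.transpose A = A \<and> (\<forall>p\<in>interior T. \<tau> p = A)"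
      by (rule exI[of _ "A' T"]) (use A' \<tau> T in simp)
  qed (rule \<tau>0)
  moreover have "energy \<T> x \<tau> T j k = energy \<T> x \<sigma> T j k + edge_shift \<T> \<beta> T (x j) (x k)"
    if jk: "j < k" "k < N" and T: "T \<in> \<T>" "{x j, x k} \<in> tri_sides T" for j k T
  proof -
    have V: "x j \<in> tri_vertices T" "x k \<in> tri_vertices T" using tri_side_subset[OF T(2)] by auto
    have "x j \<noteq> x k" using lab[of j] lab[of k] jk by auto
    then have "tri_energy T (A' T) (x j) (x k) = tri_energy T (A T) (x j) (x k) + \<delta> T (x j) (x k)"
      using A' T(1) V by simp
    moreover have "\<delta> T (x j) (x k) = edge_shift \<T> \<beta> T (x j) (x k)"
      unfolding \<delta>_def using lab[of j] lab[of k] jk by simp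
    ultimately show ?thesis
      using energy_triangle[where x=x and j=j and k=k, OF tri \<tau> \<tau>0 T(1)] energy_triangle[where x=x and j=j and k=k, OF tri A(2,3) T(1)] by simp
  qed
  ultimately show "\<exists>\<tau>. S_spec \<T> N x \<beta> \<sigma> \<tau>" unfolding S_spec_iff[OF tri \<sigma>] by (intro exI[of _ \<tau>]) simp
next
  fix \<tau> \<tau>' assume s: "S_spec \<T> N x \<beta> \<sigma> \<tau>" "S_spec \<T> N x \<beta> \<sigma> \<tau>'"
  then have PC: "\<tau> \<in> PC \<T>" "\<tau>' \<in> PC \<T>" by (simp_all add: S_spec_def)
  define A where "A = cell_matrix \<tau>"
  note A = PC_cell[OF PC(1), folded A_def]
  define A' where "A' = cell_matrix \<tau>'"
  note A' = PC_cell[OF PC(2), folded A'_def]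
  have "A T = A' T" if T: "T \<in> \<T>" for T
  proof (rule symmetric_matrix_eqI[OF triangulation_simplex[OF tri T] A(1)[OF T] A'(1)[OF T]])
    fix p q assume pq: "p \<in> tri_vertices T" "q \<in> tri_vertices T" "p \<noteq> q"
    have ord: "tri_energy T (A T) (x j) (x k) = tri_energy T (A' T) (x j) (x k)"
      if "j < k" "k < N" "{x j, x k} \<in> tri_sides T" for j k
    proof -
      have "energy \<T> x \<tau> T j k = tri_energy T (A T) (x j) (x k)"
        by (rule energy_triangle[OF tri A(2,3) T])
      moreover have "energy \<T> x \<tau>' T j k = tri_energy T (A' T) (x j) (x k)"
        by (rule energy_triangle[OF tri A'(2,3) T])
      moreover have "energy \<T> x \<tau> T j k = energy \<T> x \<tau>' T j k"
        using s that T unfolding S_spec_iff[OF tri \<sigma>] by simp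
      ultimately show ?thesis by simp
    qed
    have "p \<in> x ` {..<N}" "q \<in> x ` {..<N}"
      using x T pq by (auto simp: bij_betw_def vertices_def)
    then obtain j k where jk: "p = x j" "q = x k" "j < N" "k < N" by auto
    have side: "{x j, x k} \<in> tri_sides T" "{x k, x j} \<in> tri_sides T"
      using tri_sidesI pq jk(1,2) by simp_all
    have "j \<noteq> k" using pq jk by auto
    then consider "j < k" | "k < j" by linarith
    then show "tri_energy T (A T) p q = tri_energy T (A' T) p q"
    proof cases
      case 1
      then show ?thesis using ord[of j k] side jk by simp
    next
      case 2
      then show ?thesis
        using ord[of k j] side jk tri_energy_sym[OF A(1)[OF T], of T p q] tri_energy_sym[OF A'(1)[OF T], of T p q]
        by simp
    qed
  qed
  then show "\<tau> = \<tau>'" using PC A(2) A'(2) by (intro PC_eqI) auto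
qed

text \<open>Labels of points that are not vertices of T contribute 0.\<close>

lemma sum_bary_grad_labels:
  fixes x :: "nat \<Rightarrow> plane"
  assumes tri: "triangulation_of \<T> S" and T: "T \<in> \<T>" and x: "bij_betw x {..<N} (vertices \<T>)"
  shows "(\<Sum>k<N. bary_grad T (x k)) = 0"
proof -
  have "finite (vertices \<T>)" using x bij_betw_finite by blast
  have "(\<Sum>k<N. bary_grad T (x k)) = (\<Sum>p\<in>vertices \<T>. bary_grad T p)"
    using sum.reindex_bij_betw[OF x] .
  also have "\<dots> = (\<Sum>p\<in>tri_vertices T. bary_grad T p)"
    by (rule sum.mono_neutral_right) (use \<open>finite _\<close> T in \<open>auto simp: vertices_def bary_grad_def\<close>)
  finally show ?thesis using sum_bary_grad[OF triangulation_simplex[OF tri T]] by simp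
qed

lemma S_transform_total_energy:
  fixes x :: "nat \<Rightarrow> plane"
  assumes tri: "triangulation_of \<T> S" and x: "bij_betw x {..<N} (vertices \<T>)"
    and A: "\<And>T. T \<in> \<T> \<Longrightarrow> Finite_Cartesian_Product.transpose (A T) = A T"
      "\<And>T. T \<in> \<T> \<Longrightarrow> Finite_Cartesian_Product.transpose (A' T) = A' T"
    and shift: "\<And>j k T. j < k \<Longrightarrow> k < N \<Longrightarrow> T \<in> \<T> \<Longrightarrow> {x j, x k} \<in> tri_sides T \<Longrightarrow>
      tri_energy T (A' T) (x j) (x k) = tri_energy T (A T) (x j) (x k) + edge_shift \<T> \<beta> T (x j) (x k)"
    and jk: "j < N" "k < N"
  shows "(\<Sum>T\<in>\<T>. tri_energy T (A' T) (x j) (x k)) = (\<Sum>T\<in>\<T>. tri_energy T (A T) (x j) (x k))"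
proof -
  note fin = triangulation_finite[OF tri]
  have inj: "x a = x b \<longleftrightarrow> a = b" if "a < N" "b < N" for a b
    using x that by (auto simp: bij_betw_def inj_on_def)
  have less: "(\<Sum>T\<in>\<T>. tri_energy T (A' T) (x j) (x k)) = (\<Sum>T\<in>\<T>. tri_energy T (A T) (x j) (x k))"
    if jk: "j < k" "k < N" for j k
  proof -
    have jN: "j < N" using jk by simp
    let ?e = "{x j, x k}"
    have "(\<Sum>T\<in>\<T>. tri_energy T (A' T) (x j) (x k) - tri_energy T (A T) (x j) (x k))
       = (\<Sum>T | T \<in> \<T> \<and> ?e \<in> tri_sides T. tri_energy T (A' T) (x j) (x k) - tri_energy T (A T) (x j) (x k))"
    proof (rule sum.mono_neutral_right)
      show "\<forall>T\<in>\<T> - {T \<in> \<T>. ?e \<in> tri_sides T}.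
          tri_energy T (A' T) (x j) (x k) - tri_energy T (A T) (x j) (x k) = 0"
      proof
        fix T assume "T \<in> \<T> - {T \<in> \<T>. ?e \<in> tri_sides T}"
        \<comment> \<open>Two vertices of one triangle always form a side of it, so a triangle
          without this side misses one of the ends.\<close>
        then have "x j \<notin> tri_vertices T \<or> x k \<notin> tri_vertices T"
          using inj[OF jN jk(2)] jk tri_sidesI[of "x j" T "x k"] by auto
        then show "tri_energy T (A' T) (x j) (x k) - tri_energy T (A T) (x j) (x k) = 0"
          by (simp add: tri_energy_nonvertex)
      qed
    qed (use fin in auto)
    also have "\<dots> = (\<Sum>T | T \<in> \<T> \<and> ?e \<in> tri_sides T. edge_shift \<T> \<beta> T (x j) (x k))"
      by (intro sum.cong refl) (simp add: shift[OF jk])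
    also have "\<dots> = 0"
    proof (cases "\<exists>T\<in>\<T>. ?e \<in> tri_sides T")
      case True
      then obtain T where T: "T \<in> \<T>" "?e \<in> tri_sides T" by auto
      from triangles_at_edge[OF tri T] show ?thesis
      proof (elim disjE conjE bexE)
        assume "?e \<in> boundary_edges \<T>"
        then show ?thesis using boundary_not_interior by (simp add: edge_shift_def)
      next
        fix T' assume T': "T' \<in> \<T>" "T' \<noteq> T" "?e \<in> tri_sides T'" "{T \<in> \<T>. ?e \<in> tri_sides T} = {T, T'}"
          "ccw_side T (x j) (x k) = ccw_side T' (x k) (x j)"
        have "ccw_side T' (x k) (x j) \<longleftrightarrow> \<not> ccw_side T' (x j) (x k)"
          using ccw_side_cases[OF triangulation_simplex[OF tri T'(1)] T'(3)] by simp
        then show ?thesis unfolding T'(4) using T'(2,5) by (simp add: edge_shift_def)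
      qed
    next
      case False
      then have eq: "{T \<in> \<T>. ?e \<in> tri_sides T} = {}" by auto
      show ?thesis unfolding eq by simp
    qed
    finally show ?thesis by (simp add: sum_subtractf)
  qed
  have off: "(\<Sum>T\<in>\<T>. tri_energy T (A' T) (x j) (x k)) = (\<Sum>T\<in>\<T>. tri_energy T (A T) (x j) (x k))"
    if jk: "j < N" "k < N" "j \<noteq> k" for j k
  proof (cases "j < k")
    case False
    have "(\<Sum>T\<in>\<T>. tri_energy T (A' T) (x j) (x k)) = (\<Sum>T\<in>\<T>. tri_energy T (A' T) (x k) (x j))"
      by (intro sum.cong refl tri_energy_sym A)
    also have "\<dots> = (\<Sum>T\<in>\<T>. tri_energy T (A T) (x k) (x j))" using less[of k j] False jk by simp
    also have "\<dots> = (\<Sum>T\<in>\<T>. tri_energy T (A T) (x j) (x k))"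
      by (intro sum.cong refl tri_energy_sym A)
    finally show ?thesis .
  qed (use less jk in simp)
  show ?thesis
  proof (cases "j = k")
    case True
    \<comment> \<open>Stated for arbitrary matrices C so that it serves both A and A'; on each
      triangle the sum over all k pairs with the gradient of the constant 1.\<close>
    have row: "(\<Sum>T\<in>\<T>. tri_energy T (C T) (x j) (x j)) = - (\<Sum>k\<in>{..<N} - {j}. \<Sum>T\<in>\<T>. tri_energy T (C T) (x j) (x k))" for C
    proof -
      have "(\<Sum>k<N. tri_energy T (C T) (x j) (x k)) = 0" if "T \<in> \<T>" for T
        using sum_bary_grad_labels[OF tri that x]
        unfolding tri_energy_def by (simp flip: sum_distrib_left inner_sum_right)
      then have "(\<Sum>k<N. \<Sum>T\<in>\<T>. tri_energy T (C T) (x j) (x k)) = 0"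
        by (subst sum.swap) simp
      then show ?thesis using sum.remove[of "{..<N}" j "\<lambda>k. \<Sum>T\<in>\<T>. tri_energy T (C T) (x j) (x k)"] jk(1) by simp
    qed
    have "(\<Sum>k\<in>{..<N} - {j}. \<Sum>T\<in>\<T>. tri_energy T (A' T) (x j) (x k)) =
        (\<Sum>k\<in>{..<N} - {j}. \<Sum>T\<in>\<T>. tri_energy T (A T) (x j) (x k))"
      by (rule sum.cong[OF refl], rule off) (use jk(1) in auto)
    then show ?thesis unfolding True[symmetric] row by simp
  qed (use off jk in simp)
qed

section \<open>The discrete Dirichlet problem\<close>


lemma invertible_matI:
  fixes M :: "real Matrix.mat"
  assumes M: "M \<in> carrier_mat n n"
    and inj: "\<And>v. v \<in> carrier_vec n \<Longrightarrow> M *\<^sub>v v = 0\<^sub>v n \<Longrightarrow> v = 0\<^sub>v n"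
  shows "invertible_mat M"
proof -
  have "Determinant.det M \<noteq> 0"
    using det_0_iff_vec_prod_zero[OF M] inj by auto
  from det_non_zero_imp_unit[OF M this, unfolded Units_def, of "()"]
  obtain B where B: "B \<in> carrier_mat n n" "B * M = 1\<^sub>m n" "M * B = 1\<^sub>m n"
    by (auto simp: ring_mat_def)
  then have "inverts_mat M B \<and> inverts_mat B M"
    using M by (simp add: inverts_mat_def)
  moreover have "square_mat M" using M by simp
  ultimately show ?thesis unfolding invertible_mat_def by (intro conjI exI[of _ B]) simp_all
qed

lemma fem_matrix_mult:
  assumes "v \<in> carrier_vec N" "j < N"
  shows "vec_index (fem_matrix \<Omega> \<T> N B x \<sigma> *\<^sub>v v) j =
    (if j < B then vec_index v j else \<Sum>k<N. energy \<T> x \<sigma> \<Omega> j k * vec_index v k)"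
proof -
  have "vec_index (fem_matrix \<Omega> \<T> N B x \<sigma> *\<^sub>v v) j =
    (\<Sum>k<N. (if j < B then (if j = k then 1 else 0) else energy \<T> x \<sigma> \<Omega> j k) * vec_index v k)"
    using assms by (simp add: fem_matrix_def scalar_prod_def lessThan_atLeast0)
  also have "\<dots> = (if j < B then vec_index v j else \<Sum>k<N. energy \<T> x \<sigma> \<Omega> j k * vec_index v k)"
  proof (cases "j < B")
    case True
    have "(\<Sum>k<N. (if j = k then 1 else 0) * vec_index v k) = (\<Sum>k<N. if j = k then vec_index v j else 0)"
      by (intro sum.cong) auto
    then show ?thesis using True assms(2) by simp
  qed simp
  finally show ?thesis .
qed

text \<open>By bilinearity the double sum is the energy on T of the piecewise affine function with
  nodal values c, whose gradient on T is the combination on the right.\<close>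

lemma sum_energy_quadratic:
  "(\<Sum>j\<in>I. c j * (\<Sum>k\<in>I. tri_energy T A (x j) (x k) * c k)) =
    measure lebesgue (interior T) *
     ((A *v (\<Sum>j\<in>I. c j *\<^sub>R bary_grad T (x j))) \<bullet> (\<Sum>j\<in>I. c j *\<^sub>R bary_grad T (x j)))"
proof -
  let ?g = "\<lambda>j. bary_grad T (x j)"
  have lin: "linear (\<lambda>v. A *v v)" by (rule matrix_vector_mul_linear)
  have "(A *v (\<Sum>j\<in>I. c j *\<^sub>R ?g j)) \<bullet> (\<Sum>j\<in>I. c j *\<^sub>R ?g j) = (\<Sum>j\<in>I. \<Sum>k\<in>I. c j * (((A *v ?g j) \<bullet> ?g k) * c k))"
    unfolding linear_sum[OF lin] linear_scale[OF lin] inner_sum_left inner_sum_right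
    by (subst sum.swap) (simp add: mult_ac)
  then show ?thesis
    unfolding tri_energy_def by (simp add: sum_distrib_left mult_ac)
qed

text \<open>The function with nodal values c is constant on each triangle, so it is continuous with
  finite range on a connected set and therefore constant. No chains of neighbouring triangles are
  needed.\<close>

lemma piecewise_constant_zero:
  fixes x :: "nat \<Rightarrow> plane"
  assumes \<Omega>: "connected \<Omega>" and tri: "triangulation_of \<T> (closure \<Omega>)"
    and G: "\<And>T. T \<in> \<T> \<Longrightarrow> (\<Sum>j<N. c j *\<^sub>R bary_grad T (x j)) = 0"
    and x: "bij_betw x {..<N} (vertices \<T>)" and j0: "j0 < N" "c j0 = 0" and i: "i < N"
  shows "c i = 0"
proof -
  define u where "u z = (\<Sum>j<N. c j * hat \<T> x j z)" for z
  have uT: "u y = u z" if T: "T \<in> \<T>" "y \<in> T" "z \<in> T" for T y z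
  proof -
    have "bary T p y - bary T p z = bary_grad T p \<bullet> (y - z)" for p
      using bary_diff by (cases "p \<in> tri_vertices T") (auto simp: bary_def bary_grad_def)
    then have "u y - u z = (\<Sum>j<N. c j *\<^sub>R bary_grad T (x j)) \<bullet> (y - z)"
      unfolding u_def hat_eq_bary[OF tri T(1,2)] hat_eq_bary[OF tri T(1,3)]
      by (simp add: inner_sum_left flip: sum_subtractf right_diff_distrib)
    then show ?thesis using G[OF T(1)] by simp
  qed
  have "finite (u ` closure \<Omega>)"
  proof -
    have "u ` T \<subseteq> {u (SOME z. z \<in> T)}" if T: "T \<in> \<T>" for T
    proof
      fix r assume "r \<in> u ` T"
      then obtain z where z: "z \<in> T" "r = u z" by auto
      then have "(SOME z. z \<in> T) \<in> T" by (auto intro: someI)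
      from uT[OF T z(1) this] show "r \<in> {u (SOME z. z \<in> T)}" by (simp add: z(2))
    qed
    then have "finite (u ` T)" if "T \<in> \<T>" for T
      using finite_subset[OF _ finite.insertI[OF finite.emptyI]] that by metis
    then have "finite (\<Union>T\<in>\<T>. u ` T)" using triangulation_finite[OF tri] by simp
    then show ?thesis unfolding triangulation_Union[OF tri, symmetric] by (simp add: image_Union)
  qed
  moreover have "continuous_on (closure \<Omega>) u"
    unfolding u_def hat_def by (intro continuous_intros pl_extension(1)[OF tri])
  ultimately have "u constant_on closure \<Omega>"
    using continuous_finite_range_constant connected_imp_connected_closure \<Omega> by metis
  moreover have "x j \<in> closure \<Omega> \<and> u (x j) = c j" if j: "j < N" for j
  proof -
    have "x j \<in> vertices \<T>" using x j by (auto simp: bij_betw_def)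
    then obtain T where T: "T \<in> \<T>" "x j \<in> tri_vertices T" by (auto simp: vertices_def)
    then have xT: "x j \<in> T" using tri_vertices_subset by auto
    have "u (x j) = (\<Sum>k<N. if k = j then c j else 0)"
      unfolding u_def hat_eq_bary[OF tri T(1) xT]
    proof (intro sum.cong refl)
      fix k assume "k \<in> {..<N}"
      then have "x k = x j \<longleftrightarrow> k = j" using x j by (auto simp: bij_betw_def inj_on_def)
      then show "c k * bary T (x k) (x j) = (if k = j then c j else 0)"
        using bary_vertex[OF triangulation_simplex[OF tri T(1)], of "x k" "x j"] T(2)
        by (cases "x k \<in> tri_vertices T") (auto simp: bary_def)
    qed
    then show ?thesis using j xT triangulation_Union[OF tri] T(1) by auto
  qed
  ultimately show ?thesis using i j0 unfolding constant_on_def by metis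
qed

text \<open>The energy method: a kernel vector has energy 0, so by positivity its piecewise affine
  function has gradient 0 on every triangle. The function is then constant, and a boundary vertex
  makes the constant 0.\<close>

lemma fem_matrix_invertible:
  assumes \<Omega>: "open \<Omega>" "connected \<Omega>" "bounded \<Omega>" "\<Omega> \<noteq> {}" "interior (closure \<Omega>) = \<Omega>"
    and tri: "triangulation_of \<T> (closure \<Omega>)" and x: "vertex_labelling \<Omega> \<T> N B x"
    and \<sigma>: "\<sigma> \<in> PC_pos \<T>"
  shows "invertible_mat (fem_matrix \<Omega> \<T> N B x \<sigma>)"
proof (rule invertible_matI)
  show "fem_matrix \<Omega> \<T> N B x \<sigma> \<in> carrier_mat N N" by (simp add: fem_matrix_def)
  fix v :: "real Matrix.vec" assume v: "v \<in> carrier_vec N" "fem_matrix \<Omega> \<T> N B x \<sigma> *\<^sub>v v = 0\<^sub>v N"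
  have lab: "B \<le> N" "bij_betw x {..<N} (vertices \<T>)" "x ` {..<B} = vertices \<T> \<inter> frontier \<Omega>"
    using x by (simp_all add: vertex_labelling_def)
  have PC: "\<sigma> \<in> PC \<T>" using \<sigma> by (simp add: PC_pos_def)
  define A where "A = cell_matrix \<sigma>"
  note A = PC_cell[OF PC, folded A_def]
  define c where "c = vec_index v"
  define G where "G T = (\<Sum>j<N. c j *\<^sub>R bary_grad T (x j))" for T
  have eq: "(if j < B then c j else \<Sum>k<N. energy \<T> x \<sigma> \<Omega> j k * c k) = 0" if "j < N" for j
    unfolding c_def fem_matrix_mult[OF v(1) that, symmetric] v(2) using that by simp
  have E: "energy \<T> x \<sigma> \<Omega> j k = (\<Sum>T\<in>\<T>. tri_energy T (A T) (x j) (x k))" for j k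
    by (rule energy_domain[OF tri A(2,3) equalityD1[OF \<Omega>(5)]])
  \<comment> \<open>Each product vanishes: its first factor for a boundary label, its second factor
    for an interior label.\<close>
  have "0 = (\<Sum>j<N. c j * (\<Sum>k<N. energy \<T> x \<sigma> \<Omega> j k * c k))"
    using eq by (intro sum.neutral[symmetric]) (force split: if_splits)
  also have "\<dots> = (\<Sum>T\<in>\<T>. \<Sum>j<N. c j * (\<Sum>k<N. tri_energy T (A T) (x j) (x k) * c k))"
  proof -
    have "(\<Sum>k<N. energy \<T> x \<sigma> \<Omega> j k * c k) = (\<Sum>T\<in>\<T>. \<Sum>k<N. tri_energy T (A T) (x j) (x k) * c k)" for j
      unfolding E sum_distrib_right by (rule sum.swap)
    then show ?thesis by (simp only: sum_distrib_left[of _ _ \<T>]) (rule sum.swap)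
  qed
  also have "\<dots> = (\<Sum>T\<in>\<T>. measure lebesgue (interior T) * ((A T *v G T) \<bullet> G T))"
    unfolding sum_energy_quadratic G_def ..
  finally have sum0: "(\<Sum>T\<in>\<T>. measure lebesgue (interior T) * ((A T *v G T) \<bullet> G T)) = 0" by simp
  have pos: "(A T *v \<xi>) \<bullet> \<xi> > 0" if T: "T \<in> \<T>" and \<xi>: "\<xi> \<noteq> 0" for T \<xi>
  proof -
    obtain p where p: "p \<in> interior T" using simplex2_props(5)[OF triangulation_simplex[OF tri T]] by auto
    have "(\<sigma> p *v \<xi>) \<bullet> \<xi> > 0" using \<sigma> T p \<xi> by (simp add: PC_pos_def)
    then show ?thesis using A(2)[OF T p] by simp
  qed
  have nn: "0 \<le> measure lebesgue (interior T) * ((A T *v G T) \<bullet> G T)" if "T \<in> \<T>" for T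
    using pos[OF that, of "G T"] by (cases "G T = 0") (auto intro!: mult_nonneg_nonneg)
  have G0: "G T = 0" if T: "T \<in> \<T>" for T
  proof (rule ccontr)
    assume "G T \<noteq> 0"
    have "measure lebesgue (interior T) * ((A T *v G T) \<bullet> G T) = 0"
      using sum_nonneg_eq_0_iff[OF triangulation_finite[OF tri] nn] sum0 T by simp
    then show False
      using mult_pos_pos[OF simplex2_area_pos[OF triangulation_simplex[OF tri T]] pos[OF T \<open>G T \<noteq> 0\<close>]]
      by (simp only: less_irrefl)
  qed
  obtain p where "p \<in> vertices \<T>" "p \<in> frontier \<Omega>"
    using exists_boundary_vertex[OF tri \<Omega>(1,3,4)] by auto
  then have "p \<in> x ` {..<B}" using lab(3) by simp
  then obtain j0 where j0: "j0 < B" by auto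
  then have j0': "j0 < N" "c j0 = 0" using eq[of j0] lab(1) by simp_all
  have "c i = 0" if "i < N" for i
    by (rule piecewise_constant_zero[OF \<Omega>(2) tri G0[unfolded G_def] lab(2) j0' that])
  then show "v = 0\<^sub>v N" using v(1) unfolding c_def by (intro eq_vecI) auto
qed

section \<open>Change of variables in the energy of a triangle\<close>

text \<open>The difference e of two candidates has the same inner product with all vertices;
  expanding any y by \<open>bary_grad_span\<close> and using that the gradients add up to 0 gives e
  = 0.\<close>

lemma bary_grad_unique:
  assumes T: "2 simplex T" and p: "p \<in> tri_vertices T"
    and d: "\<And>q. q \<in> tri_vertices T \<Longrightarrow> q \<noteq> p \<Longrightarrow> d \<bullet> (q - p) = -1"
  shows "d = bary_grad T p"
proof -
  define e where "e = d - bary_grad T p"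
  have e: "e \<bullet> q = e \<bullet> p" if "q \<in> tri_vertices T" for q
  proof (cases "q = p")
    case False
    have "e \<bullet> (q - p) = 0"
      unfolding e_def inner_diff_left using d[OF that False] bary_grad_vertex[OF T p that False] by simp
    then show ?thesis by (simp add: inner_diff_right)
  qed simp
  have "e \<bullet> y = 0" for y
  proof -
    have "e \<bullet> y = (\<Sum>q\<in>tri_vertices T. (bary_grad T q \<bullet> y) * (e \<bullet> q))"
      by (subst bary_grad_span[OF T, of y, symmetric]) (simp add: inner_sum_right)
    also have "\<dots> = (\<Sum>q\<in>tri_vertices T. bary_grad T q \<bullet> y) * (e \<bullet> p)"
      unfolding sum_distrib_right using e by (intro sum.cong) auto
    also have "\<dots> = 0" using sum_bary_grad[OF T] by (simp flip: inner_sum_left)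
    finally show ?thesis .
  qed
  then have "e = 0" by (metis inner_eq_zero_iff)
  then show ?thesis by (simp add: e_def)
qed

lemma matrix_inner_transpose:
  fixes M :: "real^2^2"
  shows "(M *v u) \<bullet> v = u \<bullet> (Finite_Cartesian_Product.transpose M *v v)"
  by (simp add: inner_vec_def matrix_vector_mult_def Finite_Cartesian_Product.transpose_def sum_2 algebra_simps)

text \<open>The transpose of D = \<open>matrix L\<close> takes gradients on the image triangle to
  those on T, which absorbs the outer factors of \<open>A'\<close>, and the area factor cancels the
  division by the determinant. The hypotheses \<open>mem\<close> prevent a point that is not a
  vertex of T from landing on a vertex of the image; off T nothing else is known about
  \<open>\<Phi>\<close>.\<close>

lemma tri_energy_image:
  fixes L :: "plane \<Rightarrow> plane"
  assumes T: "2 simplex T" and L: "linear L" "inj L" and \<Phi>: "\<And>z. z \<in> T \<Longrightarrow> \<Phi> z = L z + c"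
    and A': "A' = (1 / \<bar>Determinants.det (matrix L)\<bar>) *\<^sub>R (matrix L ** A ** Finite_Cartesian_Product.transpose (matrix L))"
    and mem: "\<Phi> p \<in> \<Phi> ` tri_vertices T \<Longrightarrow> p \<in> tri_vertices T"
      "\<Phi> q \<in> \<Phi> ` tri_vertices T \<Longrightarrow> q \<in> tri_vertices T"
  shows "tri_energy (\<Phi> ` T) A' (\<Phi> p) (\<Phi> q) = tri_energy T A p q"
proof -
  note img = simplex2_affine_image[where A=L and \<Phi>=\<Phi> and c=c, OF T L \<Phi>]
  define D where "D = matrix L"
  have D: "D *v y = L y" for y unfolding D_def by (rule matrix_works[OF L(1)[unfolded linear_matrix_vector_mul_eq[symmetric]]])
  have det: "Determinants.det D \<noteq> 0" unfolding D_def using det_nz_iff_inj[OF L(1)] L(2) by simp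
  have grad: "Finite_Cartesian_Product.transpose D *v bary_grad (\<Phi> ` T) (\<Phi> r) = bary_grad T r"
    if mem: "\<Phi> r \<in> \<Phi> ` tri_vertices T \<Longrightarrow> r \<in> tri_vertices T" for r
  proof (cases "r \<in> tri_vertices T")
    case True
    show ?thesis
    proof (rule bary_grad_unique[OF T True])
      fix s assume s: "s \<in> tri_vertices T" "s \<noteq> r"
      have rs: "r \<in> T" "s \<in> T" using True s tri_vertices_subset[of T] by auto
      have ne: "\<Phi> s \<noteq> \<Phi> r" using \<Phi>[OF rs(1)] \<Phi>[OF rs(2)] s(2) injD[OF L(2), of s r] by auto
      have "(Finite_Cartesian_Product.transpose D *v bary_grad (\<Phi> ` T) (\<Phi> r)) \<bullet> (s - r)
          = bary_grad (\<Phi> ` T) (\<Phi> r) \<bullet> (D *v (s - r))"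
        using matrix_inner_transpose[of D "s - r" "bary_grad (\<Phi> ` T) (\<Phi> r)"] by (simp add: inner_commute)
      also have "D *v (s - r) = \<Phi> s - \<Phi> r"
        unfolding D \<Phi>[OF rs(1)] \<Phi>[OF rs(2)] linear_diff[OF L(1)] by simp
      also have "bary_grad (\<Phi> ` T) (\<Phi> r) \<bullet> (\<Phi> s - \<Phi> r) = -1"
        by (rule bary_grad_vertex[OF img(1)]) (use img(2) True s(1) ne in auto)
      finally show "(Finite_Cartesian_Product.transpose D *v bary_grad (\<Phi> ` T) (\<Phi> r)) \<bullet> (s - r) = -1" .
    qed
  next
    case False
    then have "\<Phi> r \<notin> tri_vertices (\<Phi> ` T)" using img(2) mem by auto
    then show ?thesis using False by (simp add: bary_grad_def)
  qed
  have gp: "Finite_Cartesian_Product.transpose D *v bary_grad (\<Phi> ` T) (\<Phi> p) = bary_grad T p"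
    by (rule grad) (rule mem(1))
  have gq: "Finite_Cartesian_Product.transpose D *v bary_grad (\<Phi> ` T) (\<Phi> q) = bary_grad T q"
    by (rule grad) (rule mem(2))
  have "(A' *v bary_grad (\<Phi> ` T) (\<Phi> p)) \<bullet> bary_grad (\<Phi> ` T) (\<Phi> q)
     = (1 / \<bar>Determinants.det D\<bar>) * ((A *v bary_grad T p) \<bullet> bary_grad T q)"
    unfolding A' D_def[symmetric] scaleR_matrix_vector_assoc[symmetric] inner_scaleR_left
      matrix_vector_mul_assoc[symmetric] gp matrix_inner_transpose[of D] gq ..
  moreover have "measure lebesgue (interior (\<Phi> ` T)) = \<bar>Determinants.det D\<bar> * measure lebesgue (interior T)"
    unfolding D_def by (rule img(4))
  ultimately show ?thesis
    unfolding tri_energy_def using det by (simp only:) simp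
qed

section \<open>Invariance of the energies\<close>


lemma pushforward_energy:
  assumes tri: "triangulation_of \<T> S" and inj: "inj_on \<Phi> S"
    and L: "\<And>T. T \<in> \<T> \<Longrightarrow> linear (L T)" "\<And>T. T \<in> \<T> \<Longrightarrow> inj (L T)"
    and \<Phi>: "\<And>T z. T \<in> \<T> \<Longrightarrow> z \<in> T \<Longrightarrow> \<Phi> z = L T z + c T"
    and A: "\<And>T p. T \<in> \<T> \<Longrightarrow> p \<in> interior T \<Longrightarrow> \<tau> p = A T"
    and D: "interior (\<Phi> ` S) \<subseteq> D" and xj: "x j \<in> S" and xk: "x k \<in> S"
  shows "energy ((`) \<Phi> ` \<T>) (\<Phi> \<circ> x) (pushforward \<T> ((`) \<Phi> ` \<T>) \<Phi> \<tau>) D j k =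
    (\<Sum>T\<in>\<T>. tri_energy T (A T) (x j) (x k))"
proof -
  let ?\<T> = "(`) \<Phi> ` \<T>"
  note U = triangulation_Union[OF tri]
  have sub: "T \<subseteq> S" if "T \<in> \<T>" for T using that U by auto
  have inj\<T>: "inj_on ((`) \<Phi>) \<T>"
    by (rule inj_onI) (use inj_on_image_eq_iff[OF inj] sub in auto)
  have img: "interior (\<Phi> ` T) = \<Phi> ` interior T" "tri_vertices (\<Phi> ` T) = \<Phi> ` tri_vertices T" if T: "T \<in> \<T>" for T
    using simplex2_affine_image(2,3)[where A="L T" and \<Phi>=\<Phi> and c="c T", OF triangulation_simplex[OF tri T] L(1)[OF T] L(2)[OF T] \<Phi>[OF T]]
    by simp_all
  define PF where "PF T = (1 / \<bar>Determinants.det (matrix (L T))\<bar>) *\<^sub>R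
      (matrix (L T) ** A T ** Finite_Cartesian_Product.transpose (matrix (L T)))" for T
  \<comment> \<open>Image triangles are referred to by their originals, which is unambiguous because
    \<open>\<Phi>\<close> is injective on S.\<close>
  define A' where "A' T' = PF (inv_into \<T> ((`) \<Phi>) T')" for T'
  have A': "A' (\<Phi> ` T) = PF T" if "T \<in> \<T>" for T
    unfolding A'_def using inv_into_f_f[OF inj\<T> that] by simp
  have pf: "pushforward \<T> ?\<T> \<Phi> \<tau> y = A' T'" if T': "T' \<in> ?\<T>" "y \<in> interior T'" for T' y
  proof -
    obtain T where T: "T \<in> \<T>" "T' = \<Phi> ` T" using T' by auto
    then obtain p where p: "p \<in> interior T" "y = \<Phi> p" using T'(2) img(1)[OF T(1)] by auto
    have "p \<in> \<Union>\<T>" using p(1) interior_subset[of T] T(1) by auto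
    then have "inv_into (\<Union>\<T>) \<Phi> y = p" unfolding p(2) using inj U by (simp add: inv_into_f_f)
    moreover have "y \<in> (\<Union>T'\<in>?\<T>. interior T')" using T' by (intro UN_I)
    moreover have "jacobian \<Phi> (at p) = matrix (L T)"
      by (rule jacobian_affine_interior[OF L(1)[OF T(1)] \<Phi>[OF T(1)] p(1)])
    ultimately show ?thesis
      unfolding pushforward_def T(2) A'[OF T(1)] PF_def A[OF T(1) p(1), symmetric] by (simp add: Let_def)
  qed
  have pf0: "pushforward \<T> ?\<T> \<Phi> \<tau> y = 0" if "y \<notin> (\<Union>T'\<in>?\<T>. interior T')" for y
    unfolding pushforward_def using that by (rule if_not_P)
  have "energy ?\<T> (\<Phi> \<circ> x) (pushforward \<T> ?\<T> \<Phi> \<tau>) D j k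
      = (\<Sum>T'\<in>?\<T>. tri_energy T' (A' T') ((\<Phi> \<circ> x) j) ((\<Phi> \<circ> x) k))"
    by (rule energy_domain[OF triangulation_image[OF tri inj L \<Phi>] pf pf0 D])
  also have "\<dots> = (\<Sum>T\<in>\<T>. tri_energy (\<Phi> ` T) (PF T) (\<Phi> (x j)) (\<Phi> (x k)))"
    unfolding sum.reindex[OF inj\<T>] using A' by (intro sum.cong) auto
  also have "\<dots> = (\<Sum>T\<in>\<T>. tri_energy T (A T) (x j) (x k))"
  proof (intro sum.cong refl)
    fix T assume T: "T \<in> \<T>"
    have mem: "p \<in> tri_vertices T" if "p \<in> S" "\<Phi> p \<in> \<Phi> ` tri_vertices T" for p
      using that inj_on_image_mem_iff[OF inj, of p "tri_vertices T"] tri_vertices_subset[of T] sub[OF T] by auto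
    show "tri_energy (\<Phi> ` T) (PF T) (\<Phi> (x j)) (\<Phi> (x k)) = tri_energy T (A T) (x j) (x k)"
      by (rule tri_energy_image[OF triangulation_simplex[OF tri T] L(1)[OF T] L(2)[OF T] \<Phi>[OF T] PF_def
            mem[OF xj] mem[OF xk]])
  qed
  finally show ?thesis .
qed

text \<open>The two kinds of conclusion have separate sources: injectivity on the closure is global
  and comes from the contraction, while the determinants concern single triangles and later give the
  orientation and the injectivity of the linear parts.\<close>

lemma deformation:
  fixes w :: "plane \<Rightarrow> plane"
  assumes \<Omega>: "open \<Omega>" "bounded \<Omega>" "interior (closure \<Omega>) = \<Omega>"
    and tri: "triangulation_of \<T> (closure \<Omega>)"
    and w: "\<forall>p \<in> vertices \<T> \<inter> frontier \<Omega>. w p = 0"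
  shows "\<exists>\<epsilon>>0. \<forall>t. \<bar>t\<bar> < \<epsilon> \<longrightarrow>
    (let g = (\<lambda>p. p + t *\<^sub>R w p); \<Phi> = pl_extension \<T> g in
     inj_on \<Phi> (closure \<Omega>) \<and> \<Phi> ` closure \<Omega> = closure \<Omega> \<and>
     (\<forall>T\<in>\<T>. Determinants.det (matrix (lin T g)) > 0))"
proof -
  define W where "W = (\<lambda>z. if z \<in> \<Omega> then pl_extension \<T> w z else 0)"
  have W: "W z = interp T w z" if "T \<in> \<T>" "z \<in> T" for T z
    unfolding W_def by (rule zero_extension_lipschitz(2)[OF \<Omega>(1,3) tri w that])
  have "\<exists>C. C-lipschitz_on UNIV W"
    unfolding W_def by (rule zero_extension_lipschitz(1)[OF \<Omega>(1,3) tri w])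
  then obtain C where C: "C-lipschitz_on UNIV W" by (elim exE)
  have "((\<lambda>t. \<bar>t\<bar> * C) \<longlongrightarrow> \<bar>0\<bar> * C) (nhds 0)" by (intro tendsto_intros filterlim_ident)
  then have "\<forall>\<^sub>F t in nhds 0. \<bar>t\<bar> * C < 1" by (rule order_tendstoD(2)) simp
  moreover have "\<forall>\<^sub>F t in nhds 0. \<forall>T\<in>\<T>. Determinants.det (matrix (lin T (\<lambda>p. p + t *\<^sub>R w p))) > 0"
    using det_perturb_pos triangulation_simplex[OF tri]
    by (intro eventually_ball_finite[OF triangulation_finite[OF tri]] ballI) simp
  ultimately have "\<forall>\<^sub>F t in nhds 0. \<bar>t\<bar> * C < 1 \<and>
      (\<forall>T\<in>\<T>. Determinants.det (matrix (lin T (\<lambda>p. p + t *\<^sub>R w p))) > 0)"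
    by (rule eventually_conj)
  then obtain \<epsilon> where \<epsilon>: "\<epsilon> > 0" "\<And>t. \<bar>t\<bar> < \<epsilon> \<Longrightarrow> \<bar>t\<bar> * C < 1 \<and>
      (\<forall>T\<in>\<T>. Determinants.det (matrix (lin T (\<lambda>p. p + t *\<^sub>R w p))) > 0)"
    unfolding eventually_nhds_metric by auto
  show ?thesis
  proof (intro exI[of _ \<epsilon>] conjI allI impI \<epsilon>(1))
    fix t :: real assume t: "\<bar>t\<bar> < \<epsilon>"
    define g where "g = (\<lambda>p. p + t *\<^sub>R w p)"
    define \<Phi> where "\<Phi> = pl_extension \<T> g"
    define F where "F = (\<lambda>z. z + t *\<^sub>R W z)"
    have bij: "bij F" unfolding F_def using bij_lipschitz_perturbation[OF C] \<epsilon>(2)[OF t] by simp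
    have \<Phi>F: "\<Phi> z = F z" if "z \<in> closure \<Omega>" for z
    proof -
      obtain T where T: "T \<in> \<T>" "z \<in> T" using \<open>z \<in> closure \<Omega>\<close> triangulation_Union[OF tri] by auto
      show ?thesis
        unfolding \<Phi>_def pl_extension(3)[OF tri T] F_def W[OF T] g_def
        by (rule interp_perturb[OF triangulation_simplex[OF tri T(1)]])
    qed
    have out: "F z = z" if "z \<notin> \<Omega>" for z using that by (simp add: F_def W_def)
    have FC: "F ` closure \<Omega> = closure \<Omega>"
    proof -
      have mem: "F z \<in> closure \<Omega> \<longleftrightarrow> z \<in> closure \<Omega>" for z
      proof (cases "z \<in> closure \<Omega>")
        case True
        \<comment> \<open>If F moved a point of the closure out of it, the image would be a fixed
          point of F, and injectivity would make it equal to the original point.\<close>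
        have "F z \<in> closure \<Omega>"
        proof (rule ccontr)
          assume n: "F z \<notin> closure \<Omega>"
          then have "F (F z) = F z" using out closure_subset[of \<Omega>] by auto
          then have "F z = z" using bij_is_inj[OF bij] by (simp add: inj_eq)
          then show False using n True by simp
        qed
        then show ?thesis using True by simp
      next
        case False
        then have "F z = z" using out closure_subset[of \<Omega>] by auto
        then show ?thesis by simp
      qed
      show ?thesis
      proof (rule equalityI; intro subsetI)
        fix y assume y: "y \<in> closure \<Omega>"
        obtain z where "y = F z" using bij_is_surj[OF bij] by (metis surjD)
        then show "y \<in> F ` closure \<Omega>" using mem y by auto
      qed (use mem in auto)
    qed
    have "inj_on \<Phi> (closure \<Omega>)"
      using \<Phi>F inj_on_subset[OF bij_is_inj[OF bij] subset_UNIV] by (simp add: inj_on_def)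
    moreover have "\<Phi> ` closure \<Omega> = closure \<Omega>" using FC \<Phi>F by (simp cong: image_cong)
    ultimately show "let g = (\<lambda>p. p + t *\<^sub>R w p); \<Phi> = pl_extension \<T> g in
     inj_on \<Phi> (closure \<Omega>) \<and> \<Phi> ` closure \<Omega> = closure \<Omega> \<and>
     (\<forall>T\<in>\<T>. Determinants.det (matrix (lin T g)) > 0)"
      using \<epsilon>(2)[OF t] unfolding Let_def g_def[symmetric] \<Phi>_def[symmetric] by simp
  qed
qed

theorem theorem1p5:
  fixes \<Omega> :: "plane set" and \<T> :: "plane set set"
    and N B :: nat and x :: "nat \<Rightarrow> plane"
    and \<sigma> :: "plane \<Rightarrow> real^2^2" and w :: "plane \<Rightarrow> plane" and \<beta> :: "plane set \<Rightarrow> real"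
  assumes "simple_polygon_interior \<Omega>"
    and "triangulation_of \<T> (closure \<Omega>)"
    and "vertex_labelling \<Omega> \<T> N B x"
    and "\<sigma> \<in> PC_pos \<T>"
    and "\<forall>p \<in> vertices \<T> \<inter> frontier \<Omega>. w p = 0"
  shows "\<exists>\<epsilon>>0. \<forall>t::real. \<bar>t\<bar> < \<epsilon> \<longrightarrow>
    (let \<Phi> = pl_extension \<T> (\<lambda>p. p + t *\<^sub>R w p);
         \<tau> = S_transform \<T> N x (\<lambda>e. t * \<beta> e) \<sigma>
     in \<exists>\<T>\<^sub>t. triangulation_of \<T>\<^sub>t (closure \<Omega>) \<and>
          triangulation_iso \<T> \<T>\<^sub>t \<Phi> \<and>
          invertible_mat (fem_matrix \<Omega> \<T> N B x \<sigma>) \<and>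
          invertible_mat (fem_matrix \<Omega> \<T>\<^sub>t N B (\<Phi> \<circ> x) (pushforward \<T> \<T>\<^sub>t \<Phi> \<tau>)) \<and>
          fem_dn_map \<Omega> \<T> N B x \<sigma> =
          fem_dn_map \<Omega> \<T>\<^sub>t N B (\<Phi> \<circ> x) (pushforward \<T> \<T>\<^sub>t \<Phi> \<tau>))"
proof -
  note \<Omega> = simple_polygon_interior_props[OF assms(1)]
  note tri = assms(2)
  have lab: "B \<le> N" "bij_betw x {..<N} (vertices \<T>)"
    using assms(3) by (simp_all add: vertex_labelling_def)
  have xS: "x j \<in> closure \<Omega>" if "j < N" for j
  proof -
    have "x j \<in> vertices \<T>" using lab(2) that by (auto simp: bij_betw_def)
    then show ?thesis
      unfolding triangulation_Union[OF tri, symmetric] vertices_def using tri_vertices_subset by auto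
  qed
  have PC: "\<sigma> \<in> PC \<T>" using assms(4) by (simp add: PC_pos_def)
  have inv: "invertible_mat (fem_matrix \<Omega> \<T> N B x \<sigma>)"
    by (rule fem_matrix_invertible[OF \<Omega> tri assms(3,4)])
  obtain \<epsilon> where \<epsilon>: "\<epsilon> > 0" "\<And>t. \<bar>t\<bar> < \<epsilon> \<Longrightarrow> 
    (let g = (\<lambda>p. p + t *\<^sub>R w p); \<Phi> = pl_extension \<T> g in
     inj_on \<Phi> (closure \<Omega>) \<and> \<Phi> ` closure \<Omega> = closure \<Omega> \<and>
     (\<forall>T\<in>\<T>. Determinants.det (matrix (lin T g)) > 0))"
    using deformation[OF \<Omega>(1,3,5) tri assms(5)] by auto
  show ?thesis
  proof (intro exI[of _ \<epsilon>] conjI allI impI \<epsilon>(1))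
    fix t :: real assume t: "\<bar>t\<bar> < \<epsilon>"
    define g where "g = (\<lambda>p. p + t *\<^sub>R w p)"
    define \<Phi> where "\<Phi> = pl_extension \<T> g"
    define \<tau> where "\<tau> = S_transform \<T> N x (\<lambda>e. t * \<beta> e) \<sigma>"
    define \<T>t where "\<T>t = (`) \<Phi> ` \<T>"
    have inj: "inj_on \<Phi> (closure \<Omega>)" and im: "\<Phi> ` closure \<Omega> = closure \<Omega>"
      and det: "\<And>T. T \<in> \<T> \<Longrightarrow> Determinants.det (matrix (lin T g)) > 0"
      using \<epsilon>(2)[OF t] unfolding Let_def g_def[symmetric] \<Phi>_def[symmetric] by simp_all
    have L: "linear (lin T g)" for T by (rule linear_lin)
    have Li: "inj (lin T g)" if "T \<in> \<T>" for T
      using det[OF that] det_nz_iff_inj[OF L, of T] by simp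
    have \<Phi>: "\<Phi> z = lin T g z + interp T g 0" if "T \<in> \<T>" "z \<in> T" for T z
      unfolding \<Phi>_def pl_extension(3)[OF tri that] by (rule interp_lin)
    have trit: "triangulation_of \<T>t (closure \<Omega>)"
      using triangulation_image[OF tri inj L Li \<Phi>] unfolding im \<T>t_def .
    have iso: "triangulation_iso \<T> \<T>t \<Phi>"
      unfolding triangulation_iso_def triangulation_Union[OF tri] triangulation_Union[OF trit]
    proof (intro conjI ballI)
      show "\<exists>\<Psi>. homeomorphism (closure \<Omega>) (closure \<Omega>) \<Phi> \<Psi>"
        by (rule homeomorphism_compact[OF _ _ im inj])
          (use \<Omega>(3) pl_extension(1)[OF tri, of g] in \<open>simp_all add: \<Phi>_def\<close>)
      fix T assume T: "T \<in> \<T>"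
      show "Determinants.det (jacobian \<Phi> (at p)) > 0" if "p \<in> interior T" for p
      proof -
        have "jacobian \<Phi> (at p) = matrix (lin T g)"
          by (rule jacobian_affine_interior[OF L \<Phi>[OF T] that])
        then show ?thesis using det[OF T] by simp
      qed
      show "affine_map_on T \<Phi>" unfolding \<Phi>_def by (rule pl_extension(2)[OF tri T])
    next
      have "inj_on ((`) \<Phi>) \<T>"
      proof (rule inj_onI)
        fix T T' assume "T \<in> \<T>" "T' \<in> \<T>" "\<Phi> ` T = \<Phi> ` T'"
        moreover have "U \<subseteq> closure \<Omega>" if "U \<in> \<T>" for U
          using that triangulation_Union[OF tri] by auto
        ultimately show "T = T'" using inj_on_image_eq_iff[OF inj] by simp
      qed
      then show "bij_betw (\<lambda>T. \<Phi> ` T) \<T> \<T>t" unfolding \<T>t_def by (rule inj_on_imp_bij_betw)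
    qed
    have spec: "S_spec \<T> N x (\<lambda>e. t * \<beta> e) \<sigma> \<tau>"
      unfolding \<tau>_def by (rule S_transform_spec[OF tri PC lab(2)])
    then have PC\<tau>: "\<tau> \<in> PC \<T>" by (simp add: S_spec_def)
    define A where "A = cell_matrix \<sigma>"
    define A' where "A' = cell_matrix \<tau>"
    note A = PC_cell[OF PC, folded A_def] and A' = PC_cell[OF PC\<tau>, folded A'_def]
    have E: "energy \<T>t (\<Phi> \<circ> x) (pushforward \<T> \<T>t \<Phi> \<tau>) \<Omega> j k = energy \<T> x \<sigma> \<Omega> j k"
      if jk: "j < N" "k < N" for j k
    proof -
      have sub: "interior (\<Phi> ` closure \<Omega>) \<subseteq> \<Omega>" unfolding im \<Omega>(5) by (rule subset_refl)
      have "energy \<T>t (\<Phi> \<circ> x) (pushforward \<T> \<T>t \<Phi> \<tau>) \<Omega> j k = (\<Sum>T\<in>\<T>. tri_energy T (A' T) (x j) (x k))"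
        unfolding \<T>t_def
        by (rule pushforward_energy[OF tri inj L Li \<Phi> A'(2) sub xS[OF jk(1)] xS[OF jk(2)]])
      also have "\<dots> = (\<Sum>T\<in>\<T>. tri_energy T (A T) (x j) (x k))"
      proof (rule S_transform_total_energy[OF tri lab(2) A(1) A'(1) _ jk])
        fix j k T assume *: "j < k" "k < N" "T \<in> \<T>" "{x j, x k} \<in> tri_sides T"
        have "energy \<T> x \<tau> T j k = tri_energy T (A' T) (x j) (x k)"
          by (rule energy_triangle[OF tri A'(2,3) *(3)])
        moreover have "energy \<T> x \<sigma> T j k = tri_energy T (A T) (x j) (x k)"
          by (rule energy_triangle[OF tri A(2,3) *(3)])
        moreover have "energy \<T> x \<tau> T j k = energy \<T> x \<sigma> T j k + edge_shift \<T> (\<lambda>e. t * \<beta> e) T (x j) (x k)"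
          using spec * unfolding S_spec_iff[OF tri PC] by simp
        ultimately show "tri_energy T (A' T) (x j) (x k) =
            tri_energy T (A T) (x j) (x k) + edge_shift \<T> (\<lambda>e. t * \<beta> e) T (x j) (x k)" by simp
      qed
      also have "\<dots> = energy \<T> x \<sigma> \<Omega> j k"
        by (rule energy_domain[OF tri A(2,3) equalityD1[OF \<Omega>(5)], symmetric])
      finally show ?thesis .
    qed
    have fem: "fem_matrix \<Omega> \<T>t N B (\<Phi> \<circ> x) (pushforward \<T> \<T>t \<Phi> \<tau>) = fem_matrix \<Omega> \<T> N B x \<sigma>"
      unfolding fem_matrix_def by (intro cong_mat) (auto simp: E)
    \<comment> \<open>The rows j < B of \<open>fem_matrix\<close> are rows of the identity, so
      \<open>fem\<close> says nothing about the energies that the map itself uses there; these agree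
      by \<open>E\<close>. The solution u is the same because the matrix is.\<close>
    have "fem_dn_map \<Omega> \<T> N B x \<sigma> = fem_dn_map \<Omega> \<T>t N B (\<Phi> \<circ> x) (pushforward \<T> \<T>t \<Phi> \<tau>)"
      unfolding fem_dn_map_def fem Let_def
    proof (rule restrict_ext, rule eq_vecI)
      fix f :: "real Matrix.vec" and j
      assume "j < dim_vec (Matrix.vec B (\<lambda>j. \<Sum>k<N. energy \<T>t (\<Phi> \<circ> x) (pushforward \<T> \<T>t \<Phi> \<tau>) \<Omega> j k *
          vec_index (THE u. u \<in> carrier_vec N \<and> fem_matrix \<Omega> \<T> N B x \<sigma> *\<^sub>v u = f @\<^sub>v 0\<^sub>v (N - B)) k))"
      then have j: "j < B" "j < N" using lab(1) by simp_all
      have "(\<Sum>k<N. energy \<T> x \<sigma> \<Omega> j k * u k) =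
          (\<Sum>k<N. energy \<T>t (\<Phi> \<circ> x) (pushforward \<T> \<T>t \<Phi> \<tau>) \<Omega> j k * u k)" for u
        using E[OF j(2)] by (intro sum.cong) simp_all
      then show "vec_index (Matrix.vec B (\<lambda>j. \<Sum>k<N. energy \<T> x \<sigma> \<Omega> j k *
          vec_index (THE u. u \<in> carrier_vec N \<and> fem_matrix \<Omega> \<T> N B x \<sigma> *\<^sub>v u = f @\<^sub>v 0\<^sub>v (N - B)) k)) j =
        vec_index (Matrix.vec B (\<lambda>j. \<Sum>k<N. energy \<T>t (\<Phi> \<circ> x) (pushforward \<T> \<T>t \<Phi> \<tau>) \<Omega> j k *
          vec_index (THE u. u \<in> carrier_vec N \<and> fem_matrix \<Omega> \<T> N B x \<sigma> *\<^sub>v u = f @\<^sub>v 0\<^sub>v (N - B)) k)) j"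
        using j(1) by simp
    qed simp
    then show "let \<Phi> = pl_extension \<T> (\<lambda>p. p + t *\<^sub>R w p);
         \<tau> = S_transform \<T> N x (\<lambda>e. t * \<beta> e) \<sigma>
     in \<exists>\<T>\<^sub>t. triangulation_of \<T>\<^sub>t (closure \<Omega>) \<and>
          triangulation_iso \<T> \<T>\<^sub>t \<Phi> \<and>
          invertible_mat (fem_matrix \<Omega> \<T> N B x \<sigma>) \<and>
          invertible_mat (fem_matrix \<Omega> \<T>\<^sub>t N B (\<Phi> \<circ> x) (pushforward \<T> \<T>\<^sub>t \<Phi> \<tau>)) \<and>
          fem_dn_map \<Omega> \<T> N B x \<sigma> =
          fem_dn_map \<Omega> \<T>\<^sub>t N B (\<Phi> \<circ> x) (pushforward \<T> \<T>\<^sub>t \<Phi> \<tau>)"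
      unfolding Let_def g_def[symmetric] \<Phi>_def[symmetric] \<tau>_def[symmetric]
      using trit iso inv fem by (intro exI[of _ \<T>t]) simp
  qed
qed

end
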